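(* Let $G$ be an ANC group and let $K$ be a field of characteristic zero. Then there exists an irreducible linear group $G(K)$ over $K$ with $G \cong G(K)$ (as abstract groups). Moreover, $G(K)$ is unique up to similarity.
   Context: An ANC group is a finite nilpotent group all of whose abelian normal subgroups are cyclic. A linear group over $K$ is a subgroup $G \le \mathrm{GL}(V)$, where $V$ is a finite-dimensional $K$-vector space. It is irreducible if $V$ is an irreducible $KG$-module. Two linear groups $G \le \mathrm{GL}(V)$ and $H \le \mathrm{GL}(W)$, both over $K$, are similar if there exists a $K$-isomorphism $\theta\colon V \to W$ with $\theta^{-1}G\theta = H$ (maps written on the right). *)

theory Defs
  imports
    "Jordan_Normal_Form.VS_Connect"
    "HOL-Algebra.Bij"
    "HOL-Algebra.Generated_Groups"
    "HOL-Algebra.Elementary_Groups"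
begin

section \<open>ANC groups\<close>

primrec lower_central_series :: "('a, 'b) monoid_scheme \<Rightarrow> nat \<Rightarrow> 'a set" where
  "lower_central_series G 0 = carrier G"
| "lower_central_series G (Suc n) =
     generate G (\<Union>x \<in> lower_central_series G n. \<Union>y \<in> carrier G.
       {x \<otimes>\<^bsub>G\<^esub> y \<otimes>\<^bsub>G\<^esub> inv\<^bsub>G\<^esub> x \<otimes>\<^bsub>G\<^esub> inv\<^bsub>G\<^esub> y})"

definition nilpotent_group :: "('a, 'b) monoid_scheme \<Rightarrow> bool" where
  "nilpotent_group G \<longleftrightarrow> group G \<and> (\<exists>n. lower_central_series G n = {\<one>\<^bsub>G\<^esub>})"

definition ANC_group :: "('a, 'b) monoid_scheme \<Rightarrow> bool" where
  "ANC_group G \<longleftrightarrow> nilpotent_group G \<and> finite (carrier G) \<and>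
     (\<forall>N. N \<lhd> G \<and> comm_group (G\<lparr>carrier := N\<rparr>) \<longrightarrow> cyclic_group (G\<lparr>carrier := N\<rparr>))"


section \<open>Linear groups\<close>

text \<open>
  As for \<^const>\<open>BijGroup\<close> and \<^const>\<open>AutoGroup\<close>, elements of the general linear group
  are functions that are \<^const>\<open>undefined\<close> outside the vector space, so that equality
  of linear maps is equality on \<^term>\<open>carrier V\<close>. Maps act from the left.
\<close>

definition GL :: "('k, 'c) ring_scheme \<Rightarrow> ('k, 'v, 'd) module_scheme \<Rightarrow> ('v \<Rightarrow> 'v) monoid" where
  "GL K V = BijGroup (carrier V) \<lparr>carrier := LinearCombinations.module_hom K V V \<inter> Bij (carrier V)\<rparr>"

definition linear_group ::
  "('k, 'c) ring_scheme \<Rightarrow> ('k, 'v, 'd) module_scheme \<Rightarrow> ('v \<Rightarrow> 'v) set \<Rightarrow> bool" where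
  "linear_group K V H \<longleftrightarrow>
     vectorspace K V \<and> vectorspace.fin_dim K V \<and> subgroup H (GL K V)"

definition irreducible_linear_group ::
  "('k, 'c) ring_scheme \<Rightarrow> ('k, 'v, 'd) module_scheme \<Rightarrow> ('v \<Rightarrow> 'v) set \<Rightarrow> bool" where
  "irreducible_linear_group K V H \<longleftrightarrow>
     linear_group K V H \<and> carrier V \<noteq> {\<zero>\<^bsub>V\<^esub>} \<and>
     (\<forall>U. VectorSpace.subspace K U V \<and> (\<forall>h \<in> H. h ` U \<subseteq> U) \<longrightarrow> U = {\<zero>\<^bsub>V\<^esub>} \<or> U = carrier V)"

definition linear_isos ::
  "('k, 'c) ring_scheme \<Rightarrow> ('k, 'v, 'd) module_scheme \<Rightarrow> ('k, 'w, 'e) module_scheme \<Rightarrow> ('v \<Rightarrow> 'w) set"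
  where "linear_isos K V W = {\<theta> \<in> LinearCombinations.module_hom K V W. bij_betw \<theta> (carrier V) (carrier W)}"

text \<open>
  With maps written on the right, similarity reads \<open>\<theta>\<inverse> G \<theta> = H\<close>; for maps acting from
  the left, the conjugate of \<open>g\<close> is \<open>\<theta> \<circ> g \<circ> \<theta>\<inverse>\<close>.
\<close>

definition similar_linear_groups ::
  "('k, 'c) ring_scheme \<Rightarrow> ('k, 'v, 'd) module_scheme \<Rightarrow> ('v \<Rightarrow> 'v) set \<Rightarrow>
   ('k, 'w, 'e) module_scheme \<Rightarrow> ('w \<Rightarrow> 'w) set \<Rightarrow> bool" where
  "similar_linear_groups K V G W H \<longleftrightarrow>
     (\<exists>\<theta> \<in> linear_isos K V W.
        (\<lambda>g. \<lambda>w \<in> carrier W. \<theta> (g (inv_into (carrier V) \<theta> w))) ` G = H)"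

end

theory Submission
  imports Defs "HOL-Algebra.Multiplicative_Group" "HOL-Number_Theory.Cong"
begin

text \<open>
  Let \<open>A = \<langle>a\<rangle>\<close> be a maximal abelian normal subgroup of an ANC group \<open>G\<close>, of order \<open>n\<close>.
  Nilpotency makes \<open>A\<close> its own centralizer, and an element \<open>g\<close> acts on \<open>A\<close> by
  \<open>a \<mapsto> a\<^bsup>s g\<^esup>\<close> with \<open>s g \<equiv> 1\<close> modulo every prime divisor of \<open>n\<close>.

  The structure of \<open>G\<close>. If an element \<open>x\<close> outside \<open>A\<close> had \<open>s x \<equiv> 1\<close> modulo 4
  (a condition only when 4 divides \<open>n\<close>), one could modify a power of it to an element of prime
  order \<open>q\<close> outside \<open>A\<close>, which together with the elements of order \<open>q\<close> in \<open>A\<close> would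
  generate a noncyclic abelian normal subgroup (\<open>mem_A_if_cong_one_mod_4\<close>). Hence \<open>A\<close> has index at
  most 2, and one finds that each power automorphism \<open>a \<mapsto> a\<^sup>k\<close> of \<open>A\<close> extends to \<open>G\<close>
  (\<open>power_automorphism\<close>).

  Uniqueness. In a faithful irreducible representation no nontrivial element of \<open>A\<close> fixes a
  nonzero vector, because it has a nontrivial central power, whose fixed space is invariant. Let
  \<open>V\<close> and \<open>W\<close> be two such representations and \<open>T : V \<rightarrow> W\<close> a nonzero linear map. A discrete
  Fourier transform writes \<open>n T\<close> as a sum of maps \<open>T\<^sub>k\<close> with \<open>T\<^sub>k a = a\<^sup>k T\<^sub>k\<close>; some
  \<open>T\<^sub>k\<close> is nonzero, and then \<open>k\<close> is coprime to \<open>n\<close>. After twisting \<open>W\<close> by an automorphism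
  extending \<open>a \<mapsto> a\<^sup>k\<close> this map commutes with \<open>A\<close>, and averaging over the cosets of \<open>A\<close> gives
  a map that commutes with \<open>G\<close>; since \<open>G/A\<close> acts faithfully on \<open>A\<close>, the average can be kept
  nonzero, as in the proof that distinct characters are independent. By Schur's lemma it is an
  isomorphism. Thus \<open>V\<close> and \<open>W\<close> agree up to an automorphism of \<open>G\<close>, which does not
  change the image of \<open>G\<close> (\<open>equivalent_up_to_automorphism\<close>). All of this happens over \<open>K\<close>
  itself; the operators of \<open>A\<close> take the place of roots of unity.

  Existence. Inside the functions \<open>G \<rightarrow> K\<close>, those whose sums over the cosets of each subgroup of
  prime order of \<open>A\<close> vanish form a nonzero invariant subspace on which no nontrivial element of
  \<open>A\<close> has a nonzero fixed vector. A minimal invariant subspace of it is irreducible, and it is faithful since a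
  nontrivial normal subgroup of \<open>G\<close> meets the self-centralizing \<open>A\<close> nontrivially
  (\<open>faithful_irrep_exists\<close>).
\<close>

section \<open>Geometric sums modulo n\<close>

lemma eq_one_or_prime_if_sole_prime_divisor:
  fixes g :: int and q :: nat
  assumes q: "prime q" and g: "g > 0"
    and only: "\<And>p :: int. prime p \<Longrightarrow> p dvd g \<Longrightarrow> p = int q"
    and sq: "\<not> int q * int q dvd g"
  shows "g = 1 \<or> g = int q"
proof (cases "g = 1")
  case False
  then obtain p :: int where p: "prime p" "p dvd g"
    using g by (metis abs_of_pos prime_divisor_exists zdvd1_eq less_irrefl)
  then have "p = int q" using only by blast
  then obtain h where h: "g = int q * h" using p by blast
  have qpos: "int q > 0" using q prime_gt_0_nat by simp
  have hpos: "h > 0" using h g qpos by (simp add: zero_less_mult_iff)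
  have "h = 1"
  proof (rule ccontr)
    assume "h \<noteq> 1"
    then obtain p' :: int where p': "prime p'" "p' dvd h"
      using hpos by (metis abs_of_pos prime_divisor_exists zdvd1_eq less_irrefl)
    then have "p' = int q" using only h by simp
    then show False using p' h sq by auto
  qed
  then show ?thesis using h by simp
qed simp

lemma geometric_sum_cong_modulus:
  fixes s d :: int
  assumes "d dvd s - 1"
  shows "[(\<Sum>i<q. s ^ i) = int q] (mod d)"
proof -
  have "[s = 1] (mod d)" using assms by (simp add: cong_iff_dvd_diff)
  then have "[(\<Sum>i<q. s ^ i) = (\<Sum>i<q. 1 ^ i)] (mod d)"
    by (intro cong_sum cong_pow)
  then show ?thesis by simp
qed

text \<open>
  The binomial expansion of \<open>(1 + (s - 1))\<^sup>i\<close>, truncated after the linear term.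
\<close>
lemma power_cong_linear_mod_square:
  fixes s p :: int
  assumes "p dvd s - 1"
  shows "[s ^ i = 1 + int i * (s - 1)] (mod p * p)"
proof -
  obtain d where d: "s = 1 + p * d" using assms by (metis add.commute diff_add_cancel dvd_def)
  show ?thesis
  proof (induction i)
    case (Suc i)
    have "[s ^ Suc i = s * (1 + int i * (s - 1))] (mod p * p)"
      using cong_scalar_left[OF Suc, of s] by simp
    also have "s * (1 + int i * (s - 1)) = 1 + int (Suc i) * (s - 1) + p * p * (int i * d * d)"
      using d by (simp add: algebra_simps)
    also have "[\<dots> = 1 + int (Suc i) * (s - 1)] (mod p * p)"
      by (simp add: cong_iff_dvd_diff)
    finally show ?case .
  qed simp
qed

text \<open>
  After linearisation the sum is \<open>q + (s - 1) q (q - 1) / 2\<close>, and \<open>(q - 1) / 2\<close> is an integer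
  because \<open>q\<close> is odd. For \<open>q = 2\<close> the claim fails, which is why the prime 2 needs a congruence modulo 4.
\<close>
lemma geometric_sum_cong_square:
  fixes s :: int and q :: nat
  assumes "odd q" and "int q dvd s - 1"
  shows "[(\<Sum>i<q. s ^ i) = int q] (mod int q * int q)"
proof -
  have "[(\<Sum>i<q. s ^ i) = (\<Sum>i<q. 1 + int i * (s - 1))] (mod int q * int q)"
    by (intro cong_sum power_cong_linear_mod_square assms)
  also have "(\<Sum>i<q. 1 + int i * (s - 1)) = int q + (\<Sum>i<q. int i) * (s - 1)"
    by (simp add: sum.distrib sum_distrib_right)
  also have "[\<dots> = int q] (mod int q * int q)"
  proof -
    obtain r where r: "q = 2 * r + 1" using assms(1) by (auto elim: oddE)
    have "(\<Sum>i<k. int i) * 2 = int k * (int k - 1)" for k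
      by (induction k) (auto simp: algebra_simps)
    from this[of q] have "(\<Sum>i<q. int i) = int q * int r"
      using r by simp
    then show ?thesis using assms(2) by (auto simp: cong_iff_dvd_diff mult_dvd_mono)
  qed
  finally show ?thesis .
qed

text \<open>
  This is the arithmetic of a power automorphism \<open>a \<mapsto> a\<^sup>s\<close> of prime order \<open>q\<close> on a cyclic
  group of order \<open>n\<close>. The geometric sum \<open>S\<close> is the exponent that appears in \<open>(a x)\<^sup>q = a\<^sup>S x\<^sup>q\<close>
  when \<open>x\<close> acts by \<open>s\<close>. A prime \<open>p\<close> dividing \<open>n\<close> and \<open>S\<close> divides \<open>q\<close>, since
  \<open>S \<equiv> q\<close> modulo \<open>p\<close>; the square of \<open>q\<close> does not divide both, by the previous lemma or, for
  \<open>q = 2\<close>, by the assumption modulo 4. If the gcd were 1, then \<open>n dvd (s - 1) S\<close> would force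
  \<open>n dvd s - 1\<close>.
\<close>
lemma geometric_sum_gcd:
  fixes n s :: int and q :: nat
  assumes q: "prime q" and n: "n > 0"
    and primes: "\<And>p :: int. prime p \<Longrightarrow> p dvd n \<Longrightarrow> p dvd s - 1"
    and four: "4 dvd n \<longrightarrow> 4 dvd s - 1"
    and pow: "n dvd s ^ q - 1" and nontriv: "\<not> n dvd s - 1"
  shows "gcd (\<Sum>i<q. s ^ i) n = int q" and "n dvd int q * (s - 1)"
proof -
  let ?S = "\<Sum>i<q. s ^ i"
  have S: "s ^ q - 1 = (s - 1) * ?S" by (rule power_diff_1_eq)
  have only: "p = int q" if p: "prime p" "p dvd gcd ?S n" for p :: int
  proof -
    have "p dvd s - 1" using p primes by simp
    from geometric_sum_cong_modulus[OF this, of q] have "p dvd int q"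
      using p by (simp add: cong_dvd_iff)
    then show ?thesis using p(1) q
      by (simp add: primes_dvd_imp_eq)
  qed
  have sq: "\<not> int q * int q dvd gcd ?S n"
  proof
    assume *: "int q * int q dvd gcd ?S n"
    then have qn: "int q * int q dvd n" and qS: "int q * int q dvd ?S" by simp_all
    then have qs: "int q dvd s - 1" using primes[of "int q"] q dvd_mult_left[OF qn] by simp
    show False
    proof (cases "q = 2")
      case True
      then have "4 dvd s - 1" "4 dvd ?S" using qn qS four by auto
      moreover have "?S = 1 + s" using True by (simp add: numeral_2_eq_2)
      ultimately have "4 dvd s - 1" "4 dvd 1 + s" by simp_all
      then show False by presburger
    next
      case False
      then have "odd q" using q prime_odd_nat[of q] prime_ge_2_nat[of q] by auto
      from geometric_sum_cong_square[OF this qs] qS have "int q * int q dvd int q"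
        by (simp add: cong_dvd_iff)
      then show False using q prime_gt_1_nat[OF q] by (simp add: zdvd_imp_le zdvd_not_zless)
    qed
  qed
  have "gcd ?S n = 1 \<or> gcd ?S n = int q"
    by (rule eq_one_or_prime_if_sole_prime_divisor[OF q _ only sq]) (use n in auto)
  moreover have "gcd ?S n \<noteq> 1"
  proof
    assume "gcd ?S n = 1"
    then have "coprime n ?S" by (simp add: coprime_iff_gcd_eq_1 gcd.commute)
    then show False using pow nontriv S by (simp add: coprime_dvd_mult_left_iff)
  qed
  ultimately show g: "gcd ?S n = int q" by blast
  have "n dvd gcd ((s - 1) * ?S) ((s - 1) * n)" using pow S by simp
  then have "n dvd \<bar>s - 1\<bar> * int q" unfolding gcd_mult_distrib_int[symmetric] g .
  then show "n dvd int q * (s - 1)"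
    by (metis abs_mult abs_of_nat dvd_abs_iff mult.commute)
qed

section \<open>Abelian normal subgroups of nilpotent groups\<close>

lemma (in group) cyclic_subgroup_generator:
  assumes N: "subgroup N G" and cyc: "cyclic_group (G\<lparr>carrier := N\<rparr>)"
  obtains x where "x \<in> N" "N = range (\<lambda>i :: int. x [^] i)"
proof -
  have grp: "group (G\<lparr>carrier := N\<rparr>)" using subgroup.subgroup_is_group[OF N is_group] .
  obtain x where x: "x \<in> N" "N = range (\<lambda>i :: int. x [^]\<^bsub>G\<lparr>carrier := N\<rparr>\<^esub> i)"
    using cyc group.cyclic_group[OF grp] by auto
  have "N = range (\<lambda>i :: int. x [^] i)"
    unfolding int_pow_consistent[OF N x(1)] by (rule x(2))
  then show thesis using that x(1) by blast
qed

lemma (in group) comm_group_on_subgroup_iff: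
  assumes N: "subgroup N G"
  shows "comm_group (G\<lparr>carrier := N\<rparr>) \<longleftrightarrow> (\<forall>x\<in>N. \<forall>y\<in>N. x \<otimes> y = y \<otimes> x)"
proof
  assume "comm_group (G\<lparr>carrier := N\<rparr>)"
  then have "comm_monoid (G\<lparr>carrier := N\<rparr>)" by (rule comm_group.axioms)
  from comm_monoid.m_comm[OF this] show "\<forall>x\<in>N. \<forall>y\<in>N. x \<otimes> y = y \<otimes> x" by simp
next
  assume *: "\<forall>x\<in>N. \<forall>y\<in>N. x \<otimes> y = y \<otimes> x"
  show "comm_group (G\<lparr>carrier := N\<rparr>)"
    by (rule group.group_comm_groupI[OF subgroup.subgroup_is_group[OF N is_group]]) (use * in auto)
qed

lemma (in group) inv_cancel:
  assumes "x \<in> carrier G" "y \<in> carrier G"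
  shows "inv x \<otimes> (x \<otimes> y) = y" "x \<otimes> (inv x \<otimes> y) = y"
  using assms by (simp_all flip: m_assoc)

lemma (in group) conj_int_pow:
  assumes "g \<in> carrier G" "x \<in> carrier G"
  shows "g \<otimes> x [^] (i :: int) \<otimes> inv g = (g \<otimes> x \<otimes> inv g) [^] i"
proof -
  have hom: "(\<lambda>x. g \<otimes> x \<otimes> inv g) \<in> hom G G"
    using assms(1) by (intro homI) (simp_all add: m_assoc inv_cancel)
  show ?thesis using hom_int_pow[OF hom assms(2) is_group, of i] by simp
qed

lemma (in group) int_pow_commutes:
  assumes "x \<otimes> y = y \<otimes> x" "x \<in> carrier G" "y \<in> carrier G"
  shows "x [^] (i :: int) \<otimes> y = y \<otimes> x [^] i"
proof -
  have "y \<otimes> x \<otimes> inv y = x" using assms by (simp add: m_assoc flip: assms(1))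
  then have "y \<otimes> x [^] i \<otimes> inv y = x [^] i" using conj_int_pow[of y x i] assms by simp
  then have "x [^] i \<otimes> y = y \<otimes> x [^] i \<otimes> inv y \<otimes> y" by simp
  also have "\<dots> = y \<otimes> x [^] i" using assms(2,3) by (simp add: m_assoc)
  finally show ?thesis .
qed

text \<open>
  The subgroup generated by an abelian normal \<open>N\<close> and an element \<open>x\<close> that centralizes \<open>N\<close>
  and is central modulo \<open>N\<close>. It serves twice: to enlarge a maximal abelian normal subgroup
  that is not self-centralizing, and to build a noncyclic abelian normal subgroup from two
  subgroups of the same prime order.
\<close>
lemma (in group) abelian_normal_extension:
  assumes N: "N \<lhd> G" and comm: "\<And>u v. u \<in> N \<Longrightarrow> v \<in> N \<Longrightarrow> u \<otimes> v = v \<otimes> u"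
    and x: "x \<in> carrier G" and xN: "\<And>u. u \<in> N \<Longrightarrow> u \<otimes> x = x \<otimes> u"
    and conj: "\<And>g. g \<in> carrier G \<Longrightarrow> \<exists>c\<in>N. g \<otimes> x \<otimes> inv g = c \<otimes> x"
  defines "B \<equiv> {u \<otimes> x [^] (j :: int) | u j. u \<in> N}"
  shows "B \<lhd> G" and "comm_group (G\<lparr>carrier := B\<rparr>)" and "N \<subseteq> B" and "x \<in> B"
proof -
  have sN: "subgroup N G" using N normal_imp_subgroup by blast
  note Nc = subgroup.mem_carrier[OF sN]
  have xjN: "x [^] (j :: int) \<otimes> u = u \<otimes> x [^] j" if "u \<in> N" for u j
    using int_pow_commutes[OF _ x Nc[OF that], of j] xN[OF that] by simp
  have mult: "(u \<otimes> x [^] i) \<otimes> (v \<otimes> x [^] j) = (u \<otimes> v) \<otimes> x [^] (i + j :: int)"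
    if "u \<in> N" "v \<in> N" for u v i j
  proof -
    have "(u \<otimes> x [^] i) \<otimes> (v \<otimes> x [^] j) = u \<otimes> (x [^] i \<otimes> v) \<otimes> x [^] j"
      using that x Nc by (simp add: m_assoc)
    also have "\<dots> = (u \<otimes> v) \<otimes> (x [^] i \<otimes> x [^] j)"
      using that x Nc by (simp add: xjN m_assoc)
    finally show ?thesis using x by (simp add: int_pow_mult)
  qed
  have sB: "subgroup B G"
  proof (rule subgroupI)
    show "B \<subseteq> carrier G" using x Nc by (auto simp: B_def)
    show "B \<noteq> {}" using subgroup.one_closed[OF sN] by (auto simp: B_def)
    show "b \<otimes> c \<in> B" if "b \<in> B" "c \<in> B" for b c
      using that mult subgroup.m_closed[OF sN] unfolding B_def by blast
    show "inv b \<in> B" if bB: "b \<in> B" for b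
    proof -
      obtain u j where b: "b = u \<otimes> x [^] (j :: int)" "u \<in> N" using bB by (auto simp: B_def)
      have iu: "inv u \<in> N" using b subgroup.m_inv_closed[OF sN] by simp
      have "inv b = x [^] (- j) \<otimes> inv u" using b x Nc by (simp add: inv_mult_group int_pow_neg)
      also have "\<dots> = inv u \<otimes> x [^] (- j)" using xjN[OF iu] .
      finally show ?thesis using iu by (auto simp: B_def)
    qed
  qed
  show "B \<lhd> G"
    unfolding normal_inv_iff
  proof (intro conjI ballI sB)
    fix g b assume g: "g \<in> carrier G" and "b \<in> B"
    then obtain u j where b: "b = u \<otimes> x [^] (j :: int)" "u \<in> N" by (auto simp: B_def)
    obtain c where c: "c \<in> N" "g \<otimes> x \<otimes> inv g = c \<otimes> x" using conj[OF g] by blast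
    have "g \<otimes> b \<otimes> inv g = (g \<otimes> u \<otimes> inv g) \<otimes> (g \<otimes> x [^] j \<otimes> inv g)"
      using b g x Nc by (simp add: m_assoc inv_cancel)
    also have "g \<otimes> x [^] j \<otimes> inv g = c [^] j \<otimes> x [^] j"
      unfolding conj_int_pow[OF g x] c(2)
      by (rule int_pow_mult_distrib[OF xN[OF c(1)] Nc[OF c(1)] x])
    also have "(g \<otimes> u \<otimes> inv g) \<otimes> (c [^] j \<otimes> x [^] j) = ((g \<otimes> u \<otimes> inv g) \<otimes> c [^] j) \<otimes> x [^] j"
      using b c g x Nc by (simp add: m_assoc)
    finally have "g \<otimes> b \<otimes> inv g = ((g \<otimes> u \<otimes> inv g) \<otimes> c [^] j) \<otimes> x [^] j" .
    moreover have "c [^] j \<in> N" 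
      by (rule subgroup_int_pow_closed[OF sN c(1)])
    moreover have "g \<otimes> u \<otimes> inv g \<in> N" using N g b by (simp add: normal_inv_iff)
    ultimately show "g \<otimes> b \<otimes> inv g \<in> B"
      using subgroup.m_closed[OF sN] by (auto simp: B_def)
  qed
  show "comm_group (G\<lparr>carrier := B\<rparr>)"
    unfolding comm_group_on_subgroup_iff[OF sB]
    using mult comm by (auto simp: B_def add.commute)
  show "N \<subseteq> B"
  proof
    fix u assume "u \<in> N"
    moreover have "u = u \<otimes> x [^] (0 :: int)" using Nc[OF \<open>u \<in> N\<close>] by simp
    ultimately show "u \<in> B" unfolding B_def by blast
  qed
  have "x = \<one> \<otimes> x [^] (1 :: int)" using x by simp
  then show "x \<in> B" using subgroup.one_closed[OF sN] unfolding B_def by blast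
qed

lemma (in group) lower_central_series_commutator:
  assumes "x \<in> lower_central_series G i" "y \<in> carrier G"
  shows "x \<otimes> y \<otimes> inv x \<otimes> inv y \<in> lower_central_series G (Suc i)"
  using assms by (auto intro!: generate.incl)

lemma (in group) lower_central_series_subgroup: "subgroup (lower_central_series G i) G"
proof (induction i)
  case 0
  show ?case by (simp add: subgroup_self)
next
  case (Suc i)
  show ?case unfolding lower_central_series.simps
    by (rule generate_is_subgroup) (use subgroup.mem_carrier[OF Suc] in auto)
qed

text \<open>
  Take \<open>N\<close> of maximal size among the abelian normal subgroups and let \<open>C\<close> be its centralizer.
  If \<open>C\<close> exceeded \<open>N\<close>, pick the last term of the lower central series that meets
  \<open>C\<close> outside \<open>N\<close>, and \<open>x\<close> in that intersection. Commutators of \<open>x\<close> lie in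
  \<open>C\<close> and in the next term, hence in \<open>N\<close>, so \<open>x\<close> is central modulo \<open>N\<close> and
  adjoining it contradicts maximality.
\<close>
lemma (in group) nilpotent_self_centralizing:
  assumes nil: "nilpotent_group G" and fin: "finite (carrier G)"
  obtains N where "N \<lhd> G" "comm_group (G\<lparr>carrier := N\<rparr>)"
    "\<And>x. x \<in> carrier G \<Longrightarrow> (\<And>u. u \<in> N \<Longrightarrow> u \<otimes> x = x \<otimes> u) \<Longrightarrow> x \<in> N"
proof -
  let ?P = "\<lambda>N. N \<lhd> G \<and> comm_group (G\<lparr>carrier := N\<rparr>)"
  have sub: "N \<subseteq> carrier G" if "N \<lhd> G" for N
    using that normal_imp_subgroup subgroup.subset by blast
  have P1: "?P {\<one>}"
    using comm_group_on_subgroup_iff[OF triv_subgroup] by (auto simp: normal_inv_iff triv_subgroup)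
  have bound: "\<forall>N. ?P N \<longrightarrow> card N < Suc (card (carrier G))"
    using sub fin by (auto simp: less_Suc_eq_le intro: card_mono)
  obtain N where N: "?P N" and max: "\<And>M. ?P M \<Longrightarrow> card M \<le> card N"
    using ex_has_greatest_nat[OF P1 bound] by blast
  have sN: "subgroup N G" using N normal_imp_subgroup by blast
  have comm: "u \<otimes> v = v \<otimes> u" if "u \<in> N" "v \<in> N" for u v
    using N that comm_group_on_subgroup_iff[OF sN] by blast
  show thesis
  proof (rule that)
    show "N \<lhd> G" "comm_group (G\<lparr>carrier := N\<rparr>)" using N by auto
    fix x0 assume x0: "x0 \<in> carrier G" "\<And>u. u \<in> N \<Longrightarrow> u \<otimes> x0 = x0 \<otimes> u"
    show "x0 \<in> N"
    proof (rule ccontr)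
      assume "x0 \<notin> N"
      define C where "C = {x \<in> carrier G. \<forall>u\<in>N. u \<otimes> x = x \<otimes> u}"
      let ?Q = "\<lambda>i. C \<inter> lower_central_series G i \<subseteq> N"
      have "\<not> ?Q 0" using x0 \<open>x0 \<notin> N\<close> by (auto simp: C_def)
      moreover obtain k where "lower_central_series G k = {\<one>}"
        using nil by (auto simp: nilpotent_group_def)
      then have "?Q k" using subgroup.one_closed[OF sN] by auto
      ultimately obtain i where i: "\<not> ?Q i" "?Q (Suc i)"
        using dec_induct[of 0 k "\<lambda>i. \<not> ?Q i"] by blast
      then obtain x where x: "x \<in> C" "x \<in> lower_central_series G i" "x \<notin> N" by blast
      then have xc: "x \<in> carrier G" and xN: "\<And>u. u \<in> N \<Longrightarrow> u \<otimes> x = x \<otimes> u" by (auto simp: C_def)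
      have conj: "\<exists>c\<in>N. g \<otimes> x \<otimes> inv g = c \<otimes> x" if g: "g \<in> carrier G" for g
      proof -
        let ?c = "x \<otimes> g \<otimes> inv x \<otimes> inv g"
        have cc: "?c \<in> carrier G" using xc g by simp
        have gx: "u \<otimes> (g \<otimes> inv x \<otimes> inv g) = (g \<otimes> inv x \<otimes> inv g) \<otimes> u" if u: "u \<in> N" for u
        proof -
          have uc: "u \<in> carrier G" using u subgroup.mem_carrier[OF sN] by blast
          define v where "v = inv g \<otimes> u \<otimes> g"
          have v: "v \<in> N" using N g u inv_closed[OF g] unfolding v_def normal_inv_iff by (metis inv_inv)
          have vc: "v \<in> carrier G" using v subgroup.mem_carrier[OF sN] by blast
          have "v \<otimes> inv x = inv x \<otimes> (x \<otimes> v) \<otimes> inv x" using xc vc by (simp add: inv_cancel)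
          also have "\<dots> = inv x \<otimes> v" unfolding xN[OF v, symmetric] using xc vc by (simp add: m_assoc)
          finally have "v \<otimes> inv x = inv x \<otimes> v" .
          then have "g \<otimes> (v \<otimes> inv x) \<otimes> inv g = g \<otimes> (inv x \<otimes> v) \<otimes> inv g" by simp
          moreover have "g \<otimes> (v \<otimes> inv x) \<otimes> inv g = u \<otimes> (g \<otimes> inv x \<otimes> inv g)"
            using g xc uc by (simp add: v_def m_assoc inv_cancel)
          moreover have "g \<otimes> (inv x \<otimes> v) \<otimes> inv g = (g \<otimes> inv x \<otimes> inv g) \<otimes> u"
            using g xc uc by (simp add: v_def m_assoc)
          ultimately show ?thesis by simp
        qed
        have "u \<otimes> ?c = ?c \<otimes> u" if u: "u \<in> N" for u
        proof -
          have uc: "u \<in> carrier G" using u subgroup.mem_carrier[OF sN] by blast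
          have c: "?c = x \<otimes> (g \<otimes> inv x \<otimes> inv g)" using xc g by (simp add: m_assoc)
          have "u \<otimes> ?c = (u \<otimes> x) \<otimes> (g \<otimes> inv x \<otimes> inv g)" using xc g uc by (simp add: m_assoc)
          also have "\<dots> = x \<otimes> (u \<otimes> (g \<otimes> inv x \<otimes> inv g))" using xN[OF u] xc g uc by (simp add: m_assoc)
          also have "\<dots> = ?c \<otimes> u" unfolding gx[OF u] using xc g uc by (simp add: m_assoc)
          finally show ?thesis .
        qed
        then have "?c \<in> C" using cc by (auto simp: C_def)
        then have "?c \<in> N" using i(2) lower_central_series_commutator[OF x(2) g] by blast
        then have ic: "inv ?c \<in> N" using subgroup.m_inv_closed[OF sN] by blast
        moreover have "g \<otimes> x \<otimes> inv g = inv ?c \<otimes> x"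
          using xc g by (simp add: inv_mult_group m_assoc inv_cancel)
        ultimately show ?thesis by blast
      qed
      let ?B = "{u \<otimes> x [^] (j :: int) | u j. u \<in> N}"
      have "?B \<lhd> G" "comm_group (G\<lparr>carrier := ?B\<rparr>)" "N \<subseteq> ?B" "x \<in> ?B"
        using abelian_normal_extension[of N x] N comm xc xN conj by auto
      then show False
        using max[of ?B] x(3) psubset_card_mono[of ?B N] finite_subset[OF sub fin, of ?B]
        by (metis (no_types, lifting) psubsetI leD)
    qed
  qed
qed

section \<open>A cyclic normal subgroup that is its own centralizer\<close>

text \<open>
  The integer \<open>s g\<close> is any exponent by which \<open>g\<close> acts on \<open>a\<close>; only its class modulo
  the order of \<open>a\<close> is determined, so all statements about \<open>s\<close> are congruences. The last
  assumption is what remains of nilpotency: the action of \<open>G\<close> on each subgroup of prime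
  order of \<open>\<langle>a\<rangle>\<close> is trivial.
\<close>
locale self_centralizing_cyclic = group G for G (structure) +
  fixes a :: 'a and s :: "'a \<Rightarrow> int"
  assumes finite_carrier: "finite (carrier G)"
    and a_closed [simp, intro]: "a \<in> carrier G"
    and conj_a: "\<And>g. g \<in> carrier G \<Longrightarrow> g \<otimes> a \<otimes> inv g = a [^] s g"
    and self_centralizing: "\<And>g. g \<in> carrier G \<Longrightarrow> g \<otimes> a = a \<otimes> g \<Longrightarrow> g \<in> range (\<lambda>i :: int. a [^] i)"
    and prime_dvd_s: "\<And>g p. g \<in> carrier G \<Longrightarrow> prime p \<Longrightarrow> p dvd int (ord a) \<Longrightarrow> p dvd s g - 1"
begin

definition A where "A = range (\<lambda>i :: int. a [^] i)"

abbreviation n where "n \<equiv> int (ord a)"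

lemma n_pos: "n > 0"
  using ord_ge_1[OF finite_carrier a_closed] by simp

lemma a_pow_eq_iff: "a [^] (i :: int) = a [^] j \<longleftrightarrow> [i = j] (mod n)"
  using int_pow_eq[OF a_closed, of i j] by (simp add: cong_iff_dvd_diff dvd_diff_commute)

lemma a_pow_eq_one_iff: "a [^] (i :: int) = \<one> \<longleftrightarrow> n dvd i"
  by (rule int_pow_eq_id[OF a_closed])

lemma a_pow_in_A [simp]: "a [^] (i :: int) \<in> A"
  by (simp add: A_def)

lemma A_closed: "x \<in> A \<Longrightarrow> x \<in> carrier G"
  by (auto simp: A_def)

lemma conj_a_pow: "g \<in> carrier G \<Longrightarrow> g \<otimes> a [^] i \<otimes> inv g = a [^] (s g * i)"
  by (simp add: conj_int_pow conj_a int_pow_pow)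

lemma a_pow_shift: "g \<in> carrier G \<Longrightarrow> g \<otimes> a [^] i = a [^] (s g * i) \<otimes> g"
  unfolding conj_a_pow[symmetric] by (simp add: m_assoc)

lemma A_subgroup: "subgroup A G"
proof (rule subgroupI)
  show "A \<subseteq> carrier G" "A \<noteq> {}" by (auto simp: A_def)
  show "inv x \<in> A" if "x \<in> A" for x
    using that by (auto simp: A_def simp flip: int_pow_neg)
  show "x \<otimes> y \<in> A" if "x \<in> A" "y \<in> A" for x y
    using that by (auto simp: A_def simp flip: int_pow_mult)
qed

lemma A_mult_left_cancel: "x \<in> A \<Longrightarrow> y \<in> carrier G \<Longrightarrow> x \<otimes> y \<in> A \<longleftrightarrow> y \<in> A"
  using subgroup.m_closed[OF A_subgroup] subgroup.m_inv_closed[OF A_subgroup] A_closed inv_cancel(1)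
  by metis

lemma s_mult: "g \<in> carrier G \<Longrightarrow> h \<in> carrier G \<Longrightarrow> [s (g \<otimes> h) = s g * s h] (mod n)"
proof -
  assume g: "g \<in> carrier G" and h: "h \<in> carrier G"
  have "a [^] s (g \<otimes> h) = g \<otimes> (h \<otimes> a \<otimes> inv h) \<otimes> inv g"
    using g h by (simp add: m_assoc inv_mult_group flip: conj_a)
  also have "\<dots> = a [^] (s g * s h)" using g h by (simp add: conj_a conj_a_pow)
  finally show ?thesis by (simp add: a_pow_eq_iff)
qed

lemma s_one: "[s \<one> = 1] (mod n)"
  using conj_a[of \<one>] a_pow_eq_iff[of "s \<one>" 1] by simp

lemma s_nat_pow: "g \<in> carrier G \<Longrightarrow> [s (g [^] (k :: nat)) = s g ^ k] (mod n)"
proof (induction k)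
  case 0
  then show ?case using s_one by simp
next
  case (Suc k)
  have "[s (g [^] k \<otimes> g) = s (g [^] k) * s g] (mod n)" using Suc by (intro s_mult) auto
  also have "[s (g [^] k) * s g = s g ^ k * s g] (mod n)" using Suc by (intro cong_scalar_right) auto
  finally show ?case by (simp add: mult.commute)
qed

lemma s_coprime: "g \<in> carrier G \<Longrightarrow> coprime (s g) n"
  using s_mult[of g "inv g"] s_one unfolding coprime_iff_invertible_int
  by (metis cong_sym cong_trans inv_closed r_inv)

text \<open>
  \<open>G/A\<close> embeds via \<open>s\<close> in the units modulo \<open>n\<close>, because \<open>A\<close> is its own centralizer.
\<close>
lemma mem_A_iff: "g \<in> carrier G \<Longrightarrow> g \<in> A \<longleftrightarrow> n dvd s g - 1"
proof
  assume g: "g \<in> carrier G" and "g \<in> A"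
  then obtain i where "g = a [^] (i :: int)" by (auto simp: A_def)
  then have "g \<otimes> a \<otimes> inv g = a [^] (i + 1 + - i)"
    by (simp only: int_pow_mult[OF a_closed] int_pow_neg[OF a_closed] int_pow_1[OF a_closed])
  then have "a [^] s g = a [^] (1 :: int)" using conj_a[OF g] by simp
  then show "n dvd s g - 1" by (simp only: a_pow_eq_iff cong_iff_dvd_diff)
next
  assume g: "g \<in> carrier G" and "n dvd s g - 1"
  then have "a [^] s g = a [^] (1 :: int)" by (simp only: a_pow_eq_iff cong_iff_dvd_diff)
  then have "g \<otimes> a = a \<otimes> g" using a_pow_shift[OF g, of 1] g by simp
  then show "g \<in> A" using self_centralizing[OF g] by (simp add: A_def)
qed

text \<open>
  The image of \<open>s\<close> modulo \<open>n\<close> is commutative, and \<open>A\<close> is its kernel.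
\<close>
lemma commutator_in_A:
  assumes g: "g \<in> carrier G" and h: "h \<in> carrier G"
  shows "g \<otimes> h \<otimes> inv g \<otimes> inv h \<in> A"
proof -
  let ?c = "g \<otimes> h \<otimes> inv g \<otimes> inv h"
  have c: "?c \<in> carrier G" using g h by simp
  have "?c \<otimes> (h \<otimes> g) = g \<otimes> h" using g h by (simp add: m_assoc inv_cancel)
  then have "[s (g \<otimes> h) = s ?c * s (h \<otimes> g)] (mod n)"
    using s_mult[OF c, of "h \<otimes> g"] g h by simp
  moreover have "[s (g \<otimes> h) = s (h \<otimes> g)] (mod n)"
    using s_mult[OF g h] s_mult[OF h g] by (metis cong_sym cong_trans mult.commute)
  ultimately have "[s ?c * s (h \<otimes> g) = 1 * s (h \<otimes> g)] (mod n)"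
    by (metis cong_sym cong_trans mult_1)
  moreover have "coprime (s (h \<otimes> g)) n" using s_coprime g h by simp
  ultimately have "[s ?c = 1] (mod n)" by (simp only: cong_mult_rcancel)
  then show ?thesis using mem_A_iff[OF c] by (simp add: cong_iff_dvd_diff)
qed

lemma a_pow_mult_pow:
  assumes x: "x \<in> carrier G"
  shows "(a [^] i \<otimes> x) [^] (k :: nat) = a [^] (i * (\<Sum>j<k. s x ^ j)) \<otimes> x [^] k"
proof (induction k)
  case (Suc k)
  have xk: "x [^] k \<in> carrier G" using x by simp
  have "(a [^] i \<otimes> x) [^] Suc k = a [^] (i * (\<Sum>j<k. s x ^ j)) \<otimes> x [^] k \<otimes> (a [^] i \<otimes> x)"
    by (simp add: Suc)
  also have "\<dots> = a [^] (i * (\<Sum>j<k. s x ^ j)) \<otimes> (x [^] k \<otimes> a [^] i) \<otimes> x"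
    using x by (simp add: m_assoc)
  also have "x [^] k \<otimes> a [^] i = a [^] (s (x [^] k) * i) \<otimes> x [^] k"
    by (rule a_pow_shift[OF xk])
  also have "a [^] (s (x [^] k) * i) = a [^] (i * s x ^ k)"
    using cong_scalar_left[OF s_nat_pow[OF x, of k], of i] by (simp add: a_pow_eq_iff mult.commute)
  also have "a [^] (i * (\<Sum>j<k. s x ^ j)) \<otimes> (a [^] (i * s x ^ k) \<otimes> x [^] k) \<otimes> x
      = (a [^] (i * (\<Sum>j<k. s x ^ j)) \<otimes> a [^] (i * s x ^ k)) \<otimes> x [^] Suc k"
    using x by (simp add: m_assoc)
  also have "a [^] (i * (\<Sum>j<k. s x ^ j)) \<otimes> a [^] (i * s x ^ k) = a [^] (i * (\<Sum>j<Suc k. s x ^ j))"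
    by (simp add: distrib_left flip: int_pow_mult)
  finally show ?case .
qed simp

text \<open>
  A suitable power of \<open>x\<close> has prime order modulo \<open>A\<close>; congruences to 1 pass to powers.
\<close>
lemma prime_step_outside_A:
  assumes x: "x \<in> carrier G" and xA: "x \<notin> A" and four: "4 dvd n \<longrightarrow> 4 dvd s x - 1"
  obtains y q where "y \<in> carrier G" "y \<notin> A" "prime q" "y [^] (q :: nat) \<in> A"
    "4 dvd n \<longrightarrow> 4 dvd s y - 1"
proof -
  let ?P = "\<lambda>r :: nat. r > 0 \<and> x [^] r \<in> A"
  define r where "r = (LEAST r. ?P r)"
  \<comment> \<open>\<open>r\<close> is the order of \<open>x\<close> modulo \<open>A\<close>\<close>
  have "?P (ord x)"
    using ord_ge_1[OF finite_carrier x] x subgroup.one_closed[OF A_subgroup] by simp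
  then have r: "?P r" unfolding r_def by (rule LeastI)
  have r_min: "\<not> ?P m" if "m < r" for m
    using that unfolding r_def by (rule not_less_Least)
  have "r \<noteq> 1" using r xA x by auto
  then obtain q where q: "prime q" "q dvd r" using prime_factor_nat by blast
  then obtain r' where r': "r = r' * q" by (auto elim: dvdE simp: mult.commute)
  have r'1: "0 < r'" "r' < r" using r r' prime_gt_1_nat[OF q(1)] by auto
  show thesis
  proof (rule that)
    show "x [^] r' \<in> carrier G" using x by simp
    show "x [^] r' \<notin> A" using r_min[OF r'1(2)] r'1 by simp
    show "prime q" by fact
    show "(x [^] r') [^] q \<in> A" using r r' x by (simp add: nat_pow_pow)
    show "4 dvd n \<longrightarrow> 4 dvd s (x [^] r') - 1"
    proof
      assume that: "4 dvd n"
      have "[s (x [^] r') = s x ^ r'] (mod 4)"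
        using s_nat_pow[OF x] that cong_dvd_modulus by blast
      also have "[s x ^ r' = 1 ^ r'] (mod 4)"
        using four that by (intro cong_pow) (simp add: cong_iff_dvd_diff)
      finally show "4 dvd s (x [^] r') - 1" by (simp add: cong_iff_dvd_diff)
    qed
  qed
qed

lemma prime_order_elt_central:
  assumes q: "prime q" "q dvd n" and g: "g \<in> carrier G"
  shows "g \<otimes> a [^] (n div q * k) = a [^] (n div q * k) \<otimes> g"
proof -
  have "n dvd n div q * (s g - 1)"
    using prime_dvd_s[OF g q] q(2) by (metis dvd_div_mult_self mult_dvd_mono dvd_refl)
  then have "n dvd n div q * (s g - 1) * k" by (rule dvd_mult2)
  then have "[s g * (n div q * k) = n div q * k] (mod n)"
    by (simp add: cong_iff_dvd_diff algebra_simps)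
  then have "a [^] (s g * (n div q * k)) = a [^] (n div q * k)" by (simp add: a_pow_eq_iff)
  then show ?thesis using a_pow_shift[OF g] by simp
qed

lemma geometric_sum_gcd_outside_A:
  assumes y: "y \<in> carrier G" "y \<notin> A" and q: "prime q" "y [^] (q :: nat) \<in> A"
    and four: "4 dvd n \<longrightarrow> 4 dvd s y - 1"
  shows "gcd (\<Sum>j<q. s y ^ j) n = int q" and "n dvd int q * (s y - 1)"
proof -
  have "n dvd s (y [^] q) - 1" using mem_A_iff[of "y [^] q"] q(2) y by simp
  then have "[s y ^ q = 1] (mod n)"
    using s_nat_pow[OF y(1), of q] by (metis cong_iff_dvd_diff cong_sym cong_trans)
  then have pow: "n dvd s y ^ q - 1" by (simp add: cong_iff_dvd_diff)
  have nontriv: "\<not> n dvd s y - 1" using mem_A_iff y by simp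
  show "gcd (\<Sum>j<q. s y ^ j) n = int q" "n dvd int q * (s y - 1)"
    using geometric_sum_gcd[OF q(1) n_pos prime_dvd_s[OF y(1)] four pow nontriv] by auto
qed

text \<open>
  Look for the required element in the form \<open>w = a\<^sup>i y\<close>. With \<open>y\<^sup>q = a\<^sup>m\<close> its \<open>q\<close>-th
  power is \<open>a\<^sup>i\<^sup>S\<^sup>+\<^sup>m\<close>, where \<open>gcd S n = q\<close>; so \<open>i\<close> exists as soon as \<open>q dvd m\<close>. This
  divisibility holds because \<open>y\<close> commutes with \<open>y\<^sup>q\<close>, while \<open>y\<close> acts nontrivially
  on \<open>a\<close> and trivially on \<open>a\<^sup>q\<close>.
\<close>
lemma prime_order_outside_A:
  assumes y: "y \<in> carrier G" "y \<notin> A" and q: "prime q" "y [^] (q :: nat) \<in> A"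
    and four: "4 dvd n \<longrightarrow> 4 dvd s y - 1"
  obtains w where "w \<in> carrier G" "w \<notin> A" "w [^] q = \<one>" "4 dvd n \<longrightarrow> 4 dvd s w - 1"
proof -
  let ?S = "\<Sum>j<q. s y ^ j"
  note G = geometric_sum_gcd_outside_A[OF assms]
  have qn: "int q dvd n" using G(1) by (metis gcd_dvd2)
  have q0: "int q > 0" using q(1) prime_gt_0_nat by simp
  define n0 where "n0 = n div int q"
  have n0: "n = int q * n0" using qn by (simp add: n0_def)
  then have n0_pos: "n0 > 0" using n_pos q0 by (metis zero_less_mult_pos)
  obtain m where m: "y [^] q = a [^] (m :: int)" using q(2) by (auto simp: A_def)
  have "y \<otimes> a [^] m = a [^] m \<otimes> y" unfolding m[symmetric] using y nat_pow_comm[of y 1 q] by simp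
  then have "a [^] (s y * m) \<otimes> y = a [^] m \<otimes> y" using a_pow_shift[OF y(1)] by simp
  then have "[s y * m = m] (mod n)" using y by (simp add: a_pow_eq_iff)
  then have sm: "n dvd (s y - 1) * m" by (simp add: cong_iff_dvd_diff algebra_simps)
  obtain j where j: "s y - 1 = n0 * j" using G(2) n0 q0 by (auto elim: dvdE)
  have "int q dvd j * m" using sm j n0 n0_pos by (simp add: mult.assoc mult.commute)
  moreover have "\<not> int q dvd j"
    using mem_A_iff y j n0 by (auto elim!: dvdE simp: mult.assoc mult.left_commute)
  ultimately have "int q dvd m" using q(1) by (simp add: prime_dvd_mult_iff)
  then obtain m0 where m0: "m = int q * m0" by (auto elim: dvdE)
  \<comment> \<open>solve \<open>i S + m \<equiv> 0\<close> for the exponent \<open>i = - u m0\<close>\<close>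
  obtain u v where "u * ?S + v * n = int q" using bezout_int[of ?S n] G(1) by auto
  then have "m = (u * ?S + v * n) * m0" by (simp add: m0)
  then have "- u * m0 * ?S + m = v * m0 * n" by (simp add: algebra_simps)
  then have i: "n dvd - u * m0 * ?S + m" by simp
  let ?w = "a [^] (- u * m0) \<otimes> y"
  have wc: "?w \<in> carrier G" using y by simp
  show thesis
  proof (rule that[OF wc])
    show "?w \<notin> A" using y by (simp add: A_mult_left_cancel)
    have "?w [^] q = a [^] (- u * m0 * ?S) \<otimes> a [^] m"
      using a_pow_mult_pow[OF y(1), of "- u * m0" q] m by simp
    then show "?w [^] q = \<one>" using i by (simp only: int_pow_mult[symmetric] a_closed a_pow_eq_one_iff)
    show "4 dvd n \<longrightarrow> 4 dvd s ?w - 1"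
    proof
      assume that: "4 dvd n"
      have "n dvd s (a [^] (- u * m0)) - 1" using mem_A_iff[of "a [^] (- u * m0)"] by simp
      then have "[s (a [^] (- u * m0)) * s y = 1 * s y] (mod n)"
        by (intro cong_scalar_right) (simp add: cong_iff_dvd_diff)
      then have "[s ?w = s y] (mod n)"
        using s_mult[of "a [^] (- u * m0)" y] y by (auto intro: cong_trans)
      then have "[s ?w = s y] (mod 4)" using that cong_dvd_modulus by blast
      moreover have "[s y = 1] (mod 4)" using four that by (simp add: cong_iff_dvd_diff)
      ultimately have "[s ?w = 1] (mod 4)" by (rule cong_trans)
      then show "4 dvd s ?w - 1" by (simp add: cong_iff_dvd_diff)
    qed
  qed
qed

text \<open>
  The main use of the hypothesis on abelian normal subgroups. An element outside \<open>A\<close> would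
  yield \<open>w\<close> of prime order \<open>q\<close> outside \<open>A\<close>. Let \<open>Z\<close> be the subgroup of order
  \<open>q\<close> in \<open>A\<close>; it is central. For \<open>g\<close> in \<open>G\<close> the conjugate of \<open>w\<close> by
  \<open>g\<close> is \<open>a\<^sup>t w\<close> and has order \<open>q\<close> again, which by \<open>gcd S n = q\<close> puts
  \<open>a\<^sup>t\<close> into \<open>Z\<close>. Hence \<open>Z\<close> and \<open>w\<close> generate an abelian normal subgroup with two different
  subgroups of order \<open>q\<close>, which is not cyclic.
\<close>
lemma mem_A_if_cong_one_mod_4:
  assumes anc: "\<And>N. N \<lhd> G \<Longrightarrow> comm_group (G\<lparr>carrier := N\<rparr>) \<Longrightarrow> cyclic_group (G\<lparr>carrier := N\<rparr>)"
    and x: "x \<in> carrier G" and four: "4 dvd n \<longrightarrow> 4 dvd s x - 1"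
  shows "x \<in> A"
proof (rule ccontr)
  assume "x \<notin> A"
  from prime_step_outside_A[OF x this four] obtain y q
    where y: "y \<in> carrier G" "y \<notin> A" "prime q" "y [^] (q :: nat) \<in> A" "4 dvd n \<longrightarrow> 4 dvd s y - 1" by blast
  from prime_order_outside_A[OF y] obtain w
    where w: "w \<in> carrier G" "w \<notin> A" "w [^] q = \<one>" and w4: "4 dvd n \<longrightarrow> 4 dvd s w - 1" by blast
  have "w [^] q \<in> A" using w subgroup.one_closed[OF A_subgroup] by simp
  note G = geometric_sum_gcd_outside_A[OF w(1,2) y(3) this w4]
  have qn: "int q dvd n" using G(1) by (metis gcd_dvd2)
  have qp: "prime (int q)" using y(3) by simp
  have q0: "int q > 0" using y(3) prime_gt_0_nat by simp
  define n0 where "n0 = n div int q"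
  have n0: "n = int q * n0" using qn by (simp add: n0_def)
  have n0_pos: "n0 > 0" using n0 n_pos q0 by (metis zero_less_mult_pos)
  let ?Z = "range (\<lambda>k :: int. a [^] (n0 * k))"
  have central: "g \<otimes> z = z \<otimes> g" if "g \<in> carrier G" "z \<in> ?Z" for g z
    using that prime_order_elt_central[OF qp qn] by (auto simp: n0_def)
  have Zc: "z \<in> carrier G" if "z \<in> ?Z" for z using that by auto
  have sZ: "subgroup ?Z G"
  proof (rule subgroupI)
    show "?Z \<subseteq> carrier G" "?Z \<noteq> {}" by auto
    show "inv z \<in> ?Z" if zZ: "z \<in> ?Z" for z
    proof -
      obtain k :: int where "z = a [^] (n0 * k)" using zZ by auto
      then have "inv z = a [^] (n0 * - k)" by (simp add: int_pow_neg)
      then show ?thesis by blast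
    qed
    show "z \<otimes> z' \<in> ?Z" if zZ: "z \<in> ?Z" "z' \<in> ?Z" for z z'
    proof -
      obtain k k' :: int where "z = a [^] (n0 * k)" "z' = a [^] (n0 * k')" using zZ by auto
      then have "z \<otimes> z' = a [^] (n0 * (k + k'))" by (simp add: int_pow_mult distrib_left)
      then show ?thesis by blast
    qed
  qed
  have nZ: "?Z \<lhd> G"
    unfolding normal_inv_iff
  proof (intro conjI ballI sZ)
    fix g z assume gz: "g \<in> carrier G" "z \<in> ?Z"
    then have "g \<otimes> z \<otimes> inv g = z" using Zc[OF gz(2)] central[OF gz] by (simp add: m_assoc)
    then show "g \<otimes> z \<otimes> inv g \<in> ?Z" using gz by simp
  qed
  \<comment> \<open>the conjugate of \<open>w\<close> has order \<open>q\<close>, which confines \<open>t\<close> to multiples of \<open>n0\<close>\<close>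
  have conj: "\<exists>c\<in>?Z. g \<otimes> w \<otimes> inv g = c \<otimes> w" if g: "g \<in> carrier G" for g
  proof -
    obtain t where t: "g \<otimes> w \<otimes> inv g \<otimes> inv w = a [^] (t :: int)"
      using commutator_in_A[OF g w(1)] by (auto simp: A_def)
    then have gw: "g \<otimes> w \<otimes> inv g = a [^] t \<otimes> w" using g w by (metis inv_solve_right m_closed inv_closed int_pow_closed a_closed)
    have "(g \<otimes> w \<otimes> inv g) [^] int q = \<one>"
      using conj_int_pow[OF g w(1), of "int q"] g w by (simp add: int_pow_int)
    then have "(a [^] t \<otimes> w) [^] q = \<one>" by (simp add: gw int_pow_int)
    then have "a [^] (t * (\<Sum>j<q. s w ^ j)) = \<one>" using a_pow_mult_pow[OF w(1)] w by simp
    then have "n dvd t * (\<Sum>j<q. s w ^ j)" by (simp add: a_pow_eq_one_iff)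
    then have "n dvd gcd (t * (\<Sum>j<q. s w ^ j)) (t * n)" by simp
    then have "n dvd \<bar>t\<bar> * int q" unfolding gcd_mult_distrib_int[symmetric] G(1) .
    then have "n0 dvd t" using n0 q0 by (simp add: mult.commute)
    then have "a [^] t \<in> ?Z" by (auto elim: dvdE)
    then show ?thesis using gw by blast
  qed
  let ?B = "{u \<otimes> w [^] (j :: int) | u j. u \<in> ?Z}"
  have comm: "u \<otimes> v = v \<otimes> u" if "u \<in> ?Z" "v \<in> ?Z" for u v
    using central[OF Zc[OF that(1)] that(2)] .
  have B: "?B \<lhd> G" "comm_group (G\<lparr>carrier := ?B\<rparr>)" "?Z \<subseteq> ?B" "w \<in> ?B"
    using abelian_normal_extension[OF nZ comm w(1) _ conj] central[OF w(1)] by force+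
  have sB: "subgroup ?B G" using B(1) normal_imp_subgroup by blast
  obtain e where e: "e \<in> ?B" "?B = range (\<lambda>i :: int. e [^] i)"
    using cyclic_subgroup_generator[OF sB anc[OF B(1,2)]] by blast
  have ec: "e \<in> carrier G" using e subgroup.mem_carrier[OF sB] by blast
  obtain u j where uj: "e = u \<otimes> w [^] (j :: int)" "u \<in> ?Z" using e(1) by blast
  have "u \<otimes> w [^] j = w [^] j \<otimes> u" using central[OF _ uj(2)] w by simp
  then have "e [^] int q = u [^] int q \<otimes> w [^] (j * int q)"
    using int_pow_mult_distrib[of u "w [^] j"] uj Zc[OF uj(2)] w by (simp add: int_pow_pow)
  moreover have "w [^] (j * int q) = \<one>"
    using int_pow_pow[OF w(1), of "int q" j] w(3) by (simp add: int_pow_int mult.commute)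
  moreover have "u [^] int q = \<one>"
  proof -
    obtain k :: int where "u = a [^] (n0 * k)" using uj(2) by auto
    then have "u [^] int q = a [^] (n * k)" by (simp add: n0 int_pow_pow ac_simps)
    then show ?thesis by (simp add: a_pow_eq_one_iff)
  qed
  \<comment> \<open>a generator \<open>e\<close> has order \<open>q\<close>, so it is a power of the element \<open>a\<^bsup>n0\<^esup>\<close> of order \<open>q\<close>\<close>
  ultimately have eq: "e [^] int q = \<one>" by simp
  have "a [^] n0 \<in> ?Z" by (rule range_eqI[of _ _ 1]) simp
  then have "a [^] n0 \<in> range (\<lambda>i :: int. e [^] i)" using B(3) e(2) by blast
  then obtain i where i: "a [^] n0 = e [^] (i :: int)" by blast
  have "\<not> int q dvd i"
  proof
    assume "int q dvd i"
    then obtain l where "i = int q * l" by (auto elim: dvdE)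
    then have "a [^] n0 = (e [^] int q) [^] l" using i ec by (simp add: int_pow_pow)
    then have "a [^] n0 = \<one>" using eq by simp
    then have "n dvd n0" by (simp add: a_pow_eq_one_iff)
    then show False using n0 n0_pos prime_gt_1_nat[OF y(3)] by (simp add: zdvd_not_zless)
  qed
  then have "coprime (int q) i" using qp prime_imp_coprime by blast
  then have "coprime i (int q)" by (simp add: coprime_commute)
  then obtain i' where i': "[i * i' = 1] (mod int q)" using coprime_iff_invertible_int by blast
  then obtain l where l: "i * i' = 1 + int q * l"
    by (metis cong_iff_lin cong_sym mult.commute)
  have "a [^] (n0 * i') = e [^] (i * i')" using i ec by (metis int_pow_pow a_closed)
  also have "\<dots> = e \<otimes> (e [^] int q) [^] l" using ec by (simp add: l int_pow_mult int_pow_pow)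
  finally have "e \<in> A" using eq ec by (metis a_pow_in_A int_pow_one r_one)
  moreover obtain k where "w = e [^] (k :: int)" using B(4) e(2) by blast
  ultimately have "w \<in> A" using subgroup_int_pow_closed[OF A_subgroup] by simp
  then show False using w by simp
qed

end

section \<open>The structure of ANC groups\<close>

locale ANC_cyclic = self_centralizing_cyclic +
  assumes anc: "\<And>N. N \<lhd> G \<Longrightarrow> comm_group (G\<lparr>carrier := N\<rparr>) \<Longrightarrow> cyclic_group (G\<lparr>carrier := N\<rparr>)"
begin

lemma outside_A_cong_three_mod_4:
  assumes g: "g \<in> carrier G" "g \<notin> A"
  shows "4 dvd n" and "[s g = 3] (mod 4)"
proof -
  have not4: "4 dvd n \<and> \<not> 4 dvd s g - 1" using mem_A_if_cong_one_mod_4[OF anc] g by blast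
  then show "4 dvd n" ..
  then have "(2 :: int) dvd n" by (meson dvd_trans dvd_def numeral_eq_iff semiring_norm mult_2 even_numeral)
  then have "2 dvd s g - 1" using prime_dvd_s[OF g(1), of 2] by simp
  then have "4 dvd s g - 3" using not4 by presburger
  then show "[s g = 3] (mod 4)" by (simp add: cong_iff_dvd_diff)
qed

text \<open>
  So \<open>A\<close> has index at most 2: the product of two exponents that are 3 modulo 4 is 1 modulo 4.
\<close>
lemma mult_outside_A:
  assumes g: "g \<in> carrier G" "g \<notin> A" and h: "h \<in> carrier G" "h \<notin> A"
  shows "g \<otimes> h \<in> A"
proof (rule mem_A_if_cong_one_mod_4[OF anc])
  show "g \<otimes> h \<in> carrier G" using g h by simp
  show "4 dvd n \<longrightarrow> 4 dvd s (g \<otimes> h) - 1"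
  proof
    assume "4 dvd n"
    then have "[s (g \<otimes> h) = s g * s h] (mod 4)"
      using s_mult[OF g(1) h(1)] cong_dvd_modulus by blast
    also have "[s g * s h = 3 * 3] (mod 4)"
      by (intro cong_mult outside_A_cong_three_mod_4 g h)
    also have "[3 * 3 = 1 :: int] (mod 4)" by (simp add: cong_def)
    finally show "4 dvd s (g \<otimes> h) - 1" by (simp add: cong_iff_dvd_diff)
  qed
qed

text \<open>
  A representative of the nontrivial coset, if there is one, whose square \<open>a\<^sup>m\<close> satisfies
  \<open>a\<^sup>2\<^sup>m = 1\<close>. Raise any representative to the odd part \<open>n'\<close> of \<open>n\<close>: this keeps it
  outside \<open>A\<close> and makes \<open>m\<close> a multiple of \<open>n'\<close>; the 2-part follows from
  \<open>n dvd (s - 1) m\<close>, where \<open>s - 1\<close> is 2 times an odd number. If \<open>G = A\<close>, the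
  representative is 1.
\<close>
lemma involutive_coset_representative:
  obtains g m where "g \<in> carrier G" "g \<otimes> g = a [^] (m :: int)" "n dvd 2 * m"
    "\<And>x. x \<in> carrier G \<Longrightarrow> x \<notin> A \<Longrightarrow> g \<notin> A"
proof (cases "carrier G \<subseteq> A")
  case True
  show thesis
    by (rule that[of \<one> 0]) (use True in auto)
next
  case False
  then obtain g where g: "g \<in> carrier G" "g \<notin> A" by blast
  note g4 = outside_A_cong_three_mod_4[OF g]
  have "ord a \<noteq> 0" using n_pos by simp
  then obtain e n' where "ord a = 2 ^ e * n'" "\<not> 2 dvd n'"
    using multiplicity_decompose'[of "ord a" 2] by (metis prime_nat_iff two_is_prime_nat not_prime_unit)
  then have n': "n = 2 ^ e * int n'" "odd n'" by auto
  obtain k where k: "n' = 2 * k + 1" using n'(2) by (auto elim: oddE)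
  let ?g = "g [^] n'"
  have gc: "?g \<in> carrier G" using g by simp
  have "[s ?g = s g ^ n'] (mod 4)"
    using s_nat_pow[OF g(1)] g4(1) cong_dvd_modulus by blast
  also have "[s g ^ n' = 3 ^ n'] (mod 4)" using g4(2) by (rule cong_pow)
  also have "(3 :: int) ^ n' = 9 ^ k * 3" by (simp add: k power_mult power_add)
  also have "[9 ^ k * 3 = 1 ^ k * (3 :: int)] (mod 4)"
    by (intro cong_mult cong_pow) (simp_all add: cong_def)
  finally have sg: "[s ?g = 3] (mod 4)" by simp
  have gA: "?g \<notin> A"
  proof
    assume "?g \<in> A"
    then have "4 dvd s ?g - 1" using mem_A_iff[OF gc] g4(1) dvd_trans by blast
    moreover have "4 dvd s ?g - 3" using sg by (simp add: cong_iff_dvd_diff)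
    ultimately show False by presburger
  qed
  obtain m0 where m0: "g \<otimes> g = a [^] (m0 :: int)" using mult_outside_A[OF g g] by (auto simp: A_def)
  let ?m = "m0 * int n'"
  have gg: "?g \<otimes> ?g = a [^] ?m"
  proof -
    have "?g \<otimes> ?g = (g \<otimes> g) [^] n'" using g by (simp add: pow_mult_distrib)
    also have "\<dots> = (a [^] m0) [^] int n'" unfolding m0 by (simp add: int_pow_int)
    finally show ?thesis by (simp add: int_pow_pow)
  qed
  have "?g \<otimes> a [^] ?m = a [^] ?m \<otimes> ?g" unfolding gg[symmetric] using gc by (simp add: m_assoc)
  then have "a [^] (s ?g * ?m) \<otimes> ?g = a [^] ?m \<otimes> ?g" using a_pow_shift[OF gc] by simp
  then have "[s ?g * ?m = ?m] (mod n)" using gc by (simp add: a_pow_eq_iff)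
  then have d: "n dvd (s ?g - 1) * ?m" by (simp add: cong_iff_dvd_diff algebra_simps)
  have "4 dvd s ?g - 3" using sg by (simp add: cong_iff_dvd_diff)
  then obtain l where "s ?g - 3 = 4 * l" by (auto elim: dvdE)
  then have l: "s ?g - 1 = 2 * (2 * l + 1)" by simp
  have "2 ^ e dvd (2 * l + 1) * (2 * ?m)"
    using d unfolding l n' by (metis dvd_mult_left mult.assoc mult.commute)
  moreover have "coprime (2 ^ e) (2 * l + 1)" by simp
  ultimately have "2 ^ e dvd 2 * ?m" by (simp add: coprime_dvd_mult_right_iff)
  moreover have "int n' dvd 2 * ?m" by simp
  moreover have "coprime (2 ^ e) (int n')" using n'(2) by simp
  ultimately have "n dvd 2 * ?m" unfolding n'(1) by (intro divides_mult)
  then show thesis using that[OF gc gg] gA by blast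
qed

text \<open>
  The automorphism is \<open>a\<^sup>i \<mapsto> a\<^sup>k\<^sup>i\<close> and \<open>a\<^sup>i g \<mapsto> a\<^sup>k\<^sup>i g\<close> for the coset representative
  \<open>g\<close> above. The only relation that could fail is \<open>g\<^sup>2 = a\<^sup>m\<close>. It survives because \<open>n\<close>
  divides \<open>(k - 1) m\<close>: it divides \<open>2 m\<close>, and \<open>k\<close> is odd if \<open>n\<close> is even.
\<close>
lemma power_automorphism:
  assumes k: "coprime k n"
  obtains \<alpha> where "\<alpha> \<in> hom G G" "inj_on \<alpha> (carrier G)" "\<alpha> a = a [^] (k :: int)"
proof -
  obtain g m where g: "g \<in> carrier G" "g \<otimes> g = a [^] (m :: int)" "n dvd 2 * m"
    and gA: "\<And>x. x \<in> carrier G \<Longrightarrow> x \<notin> A \<Longrightarrow> g \<notin> A"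
    by (rule involutive_coset_representative) blast
  have km: "n dvd (k - 1) * m"
  proof (cases "even n")
    case True
    then have "odd k" using k coprime_common_divisor[of k n 2] by auto
    then obtain l where "k - 1 = 2 * l" by (auto elim: oddE)
    then have "(k - 1) * m = 2 * m * l" by simp
    then show ?thesis using g(3) by (metis dvd_mult2)
  next
    case False
    then have "coprime n 2" by simp
    then have "n dvd m" using g(3) by (simp add: coprime_dvd_mult_right_iff)
    then show ?thesis by simp
  qed
  have ig: "inv g \<in> carrier G" using g by simp
  define \<alpha> where "\<alpha> x = (if x \<in> A then x [^] k else (x \<otimes> inv g) [^] k \<otimes> g)" for x
  have alpha_A: "\<alpha> (a [^] i) = a [^] (k * i)" for i :: int
    by (simp add: \<alpha>_def int_pow_pow mult.commute)
  have alpha_g: "\<alpha> (a [^] i \<otimes> g) = a [^] (k * i) \<otimes> g" if "g \<notin> A" for i :: int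
  proof -
    have "a [^] i \<otimes> g \<notin> A" using that g by (simp add: A_mult_left_cancel)
    moreover have "a [^] i \<otimes> g \<otimes> inv g = a [^] i" using g by (simp add: m_assoc)
    ultimately show ?thesis by (simp add: \<alpha>_def int_pow_pow mult.commute)
  qed
  have cases: "(\<exists>i :: int. x = a [^] i) \<or> g \<notin> A \<and> (\<exists>i :: int. x = a [^] i \<otimes> g)" if x: "x \<in> carrier G" for x
  proof (cases "x \<in> A")
    case False
    have gA': "g \<notin> A" using gA[OF x False] .
    then have "inv g \<notin> A" using subgroup.m_inv_closed[OF A_subgroup] g by fastforce
    then have "x \<otimes> inv g \<in> A" using mult_outside_A[OF x False ig] by blast
    then obtain i where "x \<otimes> inv g = a [^] (i :: int)" by (auto simp: A_def)
    then have "x = a [^] i \<otimes> g" using x g by (metis inv_solve_right' m_closed int_pow_closed a_closed inv_closed inv_inv inv_solve_right)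
    then show ?thesis using gA' by blast
  qed (auto simp: A_def)
  have mAA: "a [^] i \<otimes> a [^] j = a [^] (i + j)" for i j :: int
    by (simp add: int_pow_mult)
  have mAg: "a [^] i \<otimes> (a [^] j \<otimes> g) = a [^] (i + j) \<otimes> g" for i j :: int
    using g by (simp add: int_pow_mult m_assoc)
  have mgA: "(a [^] i \<otimes> g) \<otimes> a [^] j = a [^] (i + s g * j) \<otimes> g" for i j :: int
    using g a_pow_shift[OF g(1), of j] by (simp add: int_pow_mult m_assoc)
  have mgg: "(a [^] i \<otimes> g) \<otimes> (a [^] j \<otimes> g) = a [^] (i + s g * j + m)" for i j :: int
  proof -
    have "(a [^] i \<otimes> g) \<otimes> (a [^] j \<otimes> g) = ((a [^] i \<otimes> g) \<otimes> a [^] j) \<otimes> g" using g by (simp add: m_assoc)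
    also have "\<dots> = a [^] (i + s g * j) \<otimes> (g \<otimes> g)" unfolding mgA using g by (simp add: m_assoc)
    finally show ?thesis unfolding g(2) by (simp add: int_pow_mult)
  qed
  show thesis
  proof (rule that)
    show "\<alpha> a = a [^] k" using alpha_A[of 1] by simp
    show "\<alpha> \<in> hom G G"
    proof (rule homI)
      show "\<alpha> x \<in> carrier G" if "x \<in> carrier G" for x
        using that ig g A_closed by (simp add: \<alpha>_def)
      fix x y assume xy: "x \<in> carrier G" "y \<in> carrier G"
      from cases[OF xy(1)] cases[OF xy(2)] show "\<alpha> (x \<otimes> y) = \<alpha> x \<otimes> \<alpha> y"
      proof (elim disjE conjE exE)
        fix i j :: int assume *: "x = a [^] i" "y = a [^] j"
        show ?thesis unfolding * mAA alpha_A by (simp add: distrib_left)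
      next
        fix i j :: int assume *: "x = a [^] i" "g \<notin> A" "y = a [^] j \<otimes> g"
        show ?thesis unfolding *(1,3) mAg alpha_A alpha_g[OF *(2)] by (simp add: distrib_left)
      next
        fix i j :: int assume *: "g \<notin> A" "x = a [^] i \<otimes> g" "y = a [^] j"
        show ?thesis unfolding *(2,3) mgA alpha_A alpha_g[OF *(1)] by (simp add: distrib_left mult.left_commute)
      next
        fix i j :: int assume *: "g \<notin> A" "x = a [^] i \<otimes> g" "y = a [^] j \<otimes> g"
        have "[k * (i + s g * j + m) = k * i + s g * (k * j) + m] (mod n)"
          using km by (simp add: cong_iff_dvd_diff algebra_simps)
        then show ?thesis unfolding *(2,3) mgg alpha_A alpha_g[OF *(1)] by (simp only: a_pow_eq_iff)
      qed
    qed
    have inj: "[i = j] (mod n)" if "[k * i = k * j] (mod n)" for i j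
      using that k by (simp add: cong_mult_lcancel)
    show "inj_on \<alpha> (carrier G)"
    proof (rule inj_onI)
      fix x y assume xy: "x \<in> carrier G" "y \<in> carrier G" and eq: "\<alpha> x = \<alpha> y"
      from cases[OF xy(1)] cases[OF xy(2)] eq show "x = y"
      proof (elim disjE conjE exE)
        fix i j :: int assume *: "x = a [^] i" "y = a [^] j"
        show ?thesis using eq inj unfolding * alpha_A by (simp add: a_pow_eq_iff)
      next
        fix i j :: int assume *: "x = a [^] i" "g \<notin> A" "y = a [^] j \<otimes> g"
        have "a [^] (k * j) \<otimes> g \<in> A" using eq unfolding *(1,3) alpha_A alpha_g[OF *(2)] by (metis a_pow_in_A)
        then show ?thesis using *(2) g by (simp add: A_mult_left_cancel)
      next
        fix i j :: int assume *: "g \<notin> A" "x = a [^] i \<otimes> g" "y = a [^] j"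
        have "a [^] (k * i) \<otimes> g \<in> A" using eq unfolding *(2,3) alpha_A alpha_g[OF *(1)] by (metis a_pow_in_A)
        then show ?thesis using *(1) g by (simp add: A_mult_left_cancel)
      next
        fix i j :: int assume *: "g \<notin> A" "x = a [^] i \<otimes> g" "y = a [^] j \<otimes> g"
        show ?thesis using eq inj g unfolding *(2,3) alpha_g[OF *(1)] by (simp add: a_pow_eq_iff)
      qed
    qed
  qed
qed

end

text \<open>
  Otherwise \<open>g\<close> acts on \<open>z = a\<^bsup>n/p\<^esup>\<close> of order \<open>p\<close> by an exponent \<open>r\<close> with
  \<open>r - 1\<close> invertible modulo \<open>p\<close>. Then \<open>z\<close> is a power of the commutator of \<open>z\<close> and
  \<open>g\<close>, so it never leaves the lower central series.
\<close>
lemma (in group) nilpotent_conj_exponent_cong_one: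
  assumes nil: "nilpotent_group G" and a: "a \<in> carrier G" and g: "g \<in> carrier G"
    and conj: "g \<otimes> a \<otimes> inv g = a [^] (r :: int)"
    and p: "prime p" "p dvd int (ord a)" and pos: "ord a > 0"
  shows "p dvd r - 1"
proof (rule ccontr)
  assume np: "\<not> p dvd r - 1"
  have p0: "p > 1" using p prime_gt_1_int by simp
  define z where "z = a [^] (int (ord a) div p)"
  have zc: "z \<in> carrier G" using a by (simp add: z_def)
  have zp: "z [^] p = \<one>" using p(2) a by (simp add: z_def int_pow_pow int_pow_eq_id)
  have "\<not> int (ord a) dvd int (ord a) div p"
    using p0 p(2) pos by (auto elim!: dvdE simp: zdvd_not_zless zmult_eq_1_iff)
  then have z1: "z \<noteq> \<one>" using a by (simp add: z_def int_pow_eq_id)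
  have gz: "g \<otimes> z \<otimes> inv g = z [^] r"
    using conj_int_pow[OF g a] conj a by (simp add: z_def int_pow_pow mult.commute)
  have com: "z \<otimes> g \<otimes> inv z \<otimes> inv g = z [^] (1 - r)"
  proof -
    have "g \<otimes> inv z \<otimes> inv g = z [^] (- r)"
      using conj_int_pow[OF g zc, of "- 1"] gz zc by (simp add: int_pow_neg int_pow_pow)
    then have "z \<otimes> (g \<otimes> inv z \<otimes> inv g) = z [^] (1 - r)"
      using zc int_pow_mult[OF zc, of 1 "- r"] by simp
    then show ?thesis using zc g by (simp add: m_assoc)
  qed
  have "coprime p (1 - r)" using np p(1) by (metis dvd_minus_iff minus_diff_eq prime_imp_coprime)
  then obtain t where t: "[(1 - r) * t = 1] (mod p)"
    by (metis coprime_commute coprime_iff_invertible_int)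
  then obtain l where l: "(1 - r) * t = 1 + p * l"
    by (metis cong_iff_lin cong_sym mult.commute)
  have zt: "(z [^] (1 - r)) [^] t = z"
    using zc zp int_pow_pow[OF zc, of p l] by (simp add: int_pow_pow l int_pow_mult)
  have "z \<in> lower_central_series G i" for i
  proof (induction i)
    case (Suc i)
    have "z [^] (1 - r) \<in> lower_central_series G (Suc i)"
      using lower_central_series_commutator[OF Suc g] com by simp
    then have "(z [^] (1 - r)) [^] t \<in> lower_central_series G (Suc i)"
      by (rule subgroup_int_pow_closed[OF lower_central_series_subgroup])
    then show ?case unfolding zt .
  qed (simp add: zc)
  then show False using nil z1 unfolding nilpotent_group_def by blast
qed

lemma (in group) ANC_cyclic_exists:
  assumes "ANC_group G"
  obtains a s where "ANC_cyclic G a s"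
proof -
  have nil: "nilpotent_group G" and fin: "finite (carrier G)"
    and anc: "\<And>N. N \<lhd> G \<Longrightarrow> comm_group (G\<lparr>carrier := N\<rparr>) \<Longrightarrow> cyclic_group (G\<lparr>carrier := N\<rparr>)"
    using assms by (auto simp: ANC_group_def)
  obtain N where N: "N \<lhd> G" "comm_group (G\<lparr>carrier := N\<rparr>)"
    and cent: "\<And>x. x \<in> carrier G \<Longrightarrow> (\<And>u. u \<in> N \<Longrightarrow> u \<otimes> x = x \<otimes> u) \<Longrightarrow> x \<in> N"
    using nilpotent_self_centralizing[OF nil fin] by blast
  have sN: "subgroup N G" using N(1) normal_imp_subgroup by blast
  obtain a where a: "a \<in> N" "N = range (\<lambda>i :: int. a [^] i)"
    using cyclic_subgroup_generator[OF sN anc[OF N]] by blast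
  have ac: "a \<in> carrier G" using a subgroup.mem_carrier[OF sN] by blast
  have "\<forall>g\<in>carrier G. \<exists>r :: int. g \<otimes> a \<otimes> inv g = a [^] r"
  proof
    fix g assume "g \<in> carrier G"
    then have "g \<otimes> a \<otimes> inv g \<in> N" using N(1) a(1) by (simp add: normal_inv_iff)
    then show "\<exists>r :: int. g \<otimes> a \<otimes> inv g = a [^] r" using a(2) by blast
  qed
  then obtain s where s: "\<And>g. g \<in> carrier G \<Longrightarrow> g \<otimes> a \<otimes> inv g = a [^] (s g :: int)" by metis
  have "ANC_cyclic G a s"
  proof unfold_locales
    show "finite (carrier G)" "a \<in> carrier G" by fact+
    show "g \<otimes> a \<otimes> inv g = a [^] s g" if "g \<in> carrier G" for g using s[OF that] .
    show "g \<in> range (\<lambda>i :: int. a [^] i)" if g: "g \<in> carrier G" "g \<otimes> a = a \<otimes> g" for g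
    proof -
      have "a [^] (i :: int) \<otimes> g = g \<otimes> a [^] i" for i
        using int_pow_commutes[OF _ ac g(1)] g(2) by simp
      then show ?thesis using cent[OF g(1)] a(2) by blast
    qed
    show "p dvd s g - 1" if "g \<in> carrier G" "prime p" "p dvd int (ord a)" for g p
      using nilpotent_conj_exponent_cong_one[OF nil ac that(1) s[OF that(1)] that(2,3)]
        ord_ge_1[OF fin ac] by simp
    show "cyclic_group (G\<lparr>carrier := M\<rparr>)" if "M \<lhd> G" "comm_group (G\<lparr>carrier := M\<rparr>)" for M
      using anc[OF that] .
  qed
  then show thesis by (rule that)
qed

section \<open>Faithful irreducible representations\<close>

text \<open>
  Elements of prime order in \<open>A\<close> are central, and every nontrivial element of \<open>A\<close> has such a power.
\<close>
lemma (in ANC_cyclic) central_nontrivial_power: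
  assumes x: "x \<in> A" "x \<noteq> \<one>"
  obtains j :: nat where "x [^] j \<noteq> \<one>" "\<And>g. g \<in> carrier G \<Longrightarrow> g \<otimes> x [^] j = x [^] j \<otimes> g"
proof -
  have xc: "x \<in> carrier G" using A_closed x by blast
  have "ord x \<noteq> 1" using x xc ord_eq_1 by blast
  then obtain p where p: "prime p" "p dvd ord x" using prime_factor_nat by blast
  then obtain j where j: "ord x = p * j" by (auto elim: dvdE)
  have j0: "j > 0" using ord_ge_1[OF finite_carrier xc] j by (cases j) auto
  have y1: "x [^] j \<noteq> \<one>"
    using j j0 xc prime_gt_1_nat[OF p(1)] by (auto simp: pow_eq_id dest: dvd_imp_le)
  obtain i where i: "x = a [^] (i :: int)" using x by (auto simp: A_def)
  then have xj: "x [^] j = a [^] (i * int j)" by (simp add: int_pow_pow flip: int_pow_int)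
  have "x [^] (j * p) = \<one>" using j xc by (simp add: pow_eq_id mult.commute)
  then have np: "n dvd i * int j * int p"
    using i by (simp add: int_pow_pow a_pow_eq_one_iff mult.assoc flip: int_pow_int)
  have "\<not> coprime n (int p)"
    using np y1 xj by (auto simp: a_pow_eq_one_iff coprime_dvd_mult_left_iff)
  then have pn: "int p dvd n"
    using p(1) prime_imp_coprime[of "int p" n] by (auto simp: coprime_commute)
  show thesis
  proof (rule that[OF y1])
    fix g assume g: "g \<in> carrier G"
    have "int p dvd s g - 1" using prime_dvd_s[OF g _ pn] p(1) by simp
    then have "n dvd i * int j * (s g - 1)" using np by (meson dvd_refl dvd_trans mult_dvd_mono)
    then have "[s g * (i * int j) = i * int j] (mod n)" by (simp add: cong_iff_dvd_diff algebra_simps)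
    then have "a [^] (s g * (i * int j)) = a [^] (i * int j)" by (simp only: a_pow_eq_iff)
    then show "g \<otimes> x [^] j = x [^] j \<otimes> g" using a_pow_shift[OF g, of "i * int j"] xj by simp
  qed
qed

lemma (in abelian_group) minus_eq_zero_iff:
  assumes "x \<in> carrier G" "y \<in> carrier G"
  shows "x \<ominus> y = \<zero> \<longleftrightarrow> x = y"
proof
  assume "x \<ominus> y = \<zero>"
  then have "\<ominus> (\<ominus> y) = x" using assms by (intro minus_equality) (simp_all add: minus_eq)
  then show "x = y" using assms by simp
qed (use assms in \<open>simp add: minus_eq r_neg\<close>)

lemma (in abelian_group) finsum_shift:
  assumes f: "f \<in> {..Suc N} \<rightarrow> carrier G" and period: "f (Suc N) = f 0"
  shows "(\<Oplus>i\<in>{..N}. f (Suc i)) = (\<Oplus>i\<in>{..N}. f i)"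
proof -
  have c: "(\<Oplus>i\<in>{..N}. f (Suc i)) \<in> carrier G" "(\<Oplus>i\<in>{..N}. f i) \<in> carrier G" "f 0 \<in> carrier G"
    using f by (auto intro!: finsum_closed)
  have "(\<Oplus>i\<in>{..N}. f (Suc i)) \<oplus> f 0 = f (Suc N) \<oplus> (\<Oplus>i\<in>{..N}. f i)"
    using finsum_Suc[OF f] finsum_Suc2[OF f] by simp
  then show ?thesis using c period by (simp add: a_comm)
qed

lemma (in abelian_monoid) finsum_swap_atMost:
  assumes f: "\<And>i j. f i j \<in> carrier G"
  shows "(\<Oplus>i\<in>{..N::nat}. \<Oplus>j\<in>{..M::nat}. f i j) = (\<Oplus>j\<in>{..M}. \<Oplus>i\<in>{..N}. f i j)"
proof (induction N)
  case 0
  have "(\<lambda>i. \<Oplus>j\<in>{..M}. f i j) \<in> {..0} \<rightarrow> carrier G" "\<And>j. (\<lambda>i. f i j) \<in> {..0} \<rightarrow> carrier G" using f by auto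
  then show ?case by (simp add: finsum_0)
next
  case (Suc N)
  have c: "(\<lambda>i. \<Oplus>j\<in>{..M}. f i j) \<in> {..Suc N} \<rightarrow> carrier G" "\<And>j. (\<lambda>i. f i j) \<in> {..Suc N} \<rightarrow> carrier G"
    "(\<lambda>j. f (Suc N) j) \<in> {..M} \<rightarrow> carrier G" "(\<lambda>j. \<Oplus>i\<in>{..N}. f i j) \<in> {..M} \<rightarrow> carrier G"
    using f by auto
  show ?case unfolding finsum_Suc[OF c(1)] finsum_Suc[OF c(2)] Suc finsum_addf[OF c(3,4)] ..
qed

text \<open>
  Representations are functions \<open>\<rho>\<close> on all of the type of vectors, of which only the values on
  the carrier of \<open>V\<close> matter; this makes twisting by an automorphism and passing to a subspace
  a matter of composition and restriction of the carrier.
\<close>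
locale faithful_irrep = V: vectorspace "class_ring :: 'k ring" V
  for V :: "('k :: field_char_0, 'v) module" +
  fixes G :: "('a, 'b) monoid_scheme" and \<rho> :: "'a \<Rightarrow> 'v \<Rightarrow> 'v"
  assumes G: "group G"
    and closed [simp, intro]: "\<lbrakk>g \<in> carrier G; v \<in> carrier V\<rbrakk> \<Longrightarrow> \<rho> g v \<in> carrier V"
    and add [simp]: "\<lbrakk>g \<in> carrier G; u \<in> carrier V; v \<in> carrier V\<rbrakk> \<Longrightarrow> \<rho> g (u \<oplus>\<^bsub>V\<^esub> v) = \<rho> g u \<oplus>\<^bsub>V\<^esub> \<rho> g v"
    and smult [simp]: "\<lbrakk>g \<in> carrier G; v \<in> carrier V\<rbrakk> \<Longrightarrow> \<rho> g (c \<odot>\<^bsub>V\<^esub> v) = c \<odot>\<^bsub>V\<^esub> \<rho> g v"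
    and mult: "\<lbrakk>g \<in> carrier G; h \<in> carrier G; v \<in> carrier V\<rbrakk> \<Longrightarrow> \<rho> (g \<otimes>\<^bsub>G\<^esub> h) v = \<rho> g (\<rho> h v)"
    and one: "v \<in> carrier V \<Longrightarrow> \<rho> \<one>\<^bsub>G\<^esub> v = v"
    and faithful: "\<lbrakk>g \<in> carrier G; \<And>v. v \<in> carrier V \<Longrightarrow> \<rho> g v = v\<rbrakk> \<Longrightarrow> g = \<one>\<^bsub>G\<^esub>"
    and nontrivial: "carrier V \<noteq> {\<zero>\<^bsub>V\<^esub>}"
    and irreducible: "\<lbrakk>VectorSpace.subspace class_ring U V; \<And>g u. g \<in> carrier G \<Longrightarrow> u \<in> U \<Longrightarrow> \<rho> g u \<in> U\<rbrakk>
      \<Longrightarrow> U = {\<zero>\<^bsub>V\<^esub>} \<or> U = carrier V"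
begin

lemma subspaceI:
  assumes "U \<subseteq> carrier V" "\<zero>\<^bsub>V\<^esub> \<in> U" "\<And>u v. u \<in> U \<Longrightarrow> v \<in> U \<Longrightarrow> u \<oplus>\<^bsub>V\<^esub> v \<in> U"
    "\<And>c u. u \<in> U \<Longrightarrow> c \<odot>\<^bsub>V\<^esub> u \<in> U"
  shows "VectorSpace.subspace class_ring U V"
  using assms V.vectorspace_axioms V.module_axioms
  by (auto simp: VectorSpace.subspace_def LinearCombinations.submodule_def)

lemma rho_zero [simp]: "g \<in> carrier G \<Longrightarrow> \<rho> g \<zero>\<^bsub>V\<^esub> = \<zero>\<^bsub>V\<^esub>"
  using smult[of g "\<zero>\<^bsub>V\<^esub>" 0] V.lmult_0 by simp

lemma rho_minus: "g \<in> carrier G \<Longrightarrow> v \<in> carrier V \<Longrightarrow> \<rho> g (\<ominus>\<^bsub>V\<^esub> v) = \<ominus>\<^bsub>V\<^esub> \<rho> g v"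
  using smult[of g v "- 1"] V.smult_minus_1[of v] V.smult_minus_1[of "\<rho> g v"] closed
  by (simp add: class_ring_simps del: smult)

lemma rho_inv_cancel:
  assumes "g \<in> carrier G" "v \<in> carrier V"
  shows "\<rho> g (\<rho> (inv\<^bsub>G\<^esub> g) v) = v" "\<rho> (inv\<^bsub>G\<^esub> g) (\<rho> g v) = v"
  using assms G by (simp_all flip: mult add: group.r_inv group.l_inv one)

text \<open>
  The fixed space of a central element is an invariant subspace.
\<close>
lemma central_fixed_vector_zero:
  assumes z: "z \<in> carrier G" "z \<noteq> \<one>\<^bsub>G\<^esub>" and central: "\<And>g. g \<in> carrier G \<Longrightarrow> g \<otimes>\<^bsub>G\<^esub> z = z \<otimes>\<^bsub>G\<^esub> g"
    and v: "v \<in> carrier V" "\<rho> z v = v"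
  shows "v = \<zero>\<^bsub>V\<^esub>"
proof -
  let ?U = "{v \<in> carrier V. \<rho> z v = v}"
  have "?U = {\<zero>\<^bsub>V\<^esub>} \<or> ?U = carrier V"
  proof (rule irreducible)
    show "VectorSpace.subspace class_ring ?U V"
      by (rule subspaceI) (use z in \<open>auto intro: V.smult_closed\<close>)
    show "\<rho> g u \<in> ?U" if "g \<in> carrier G" "u \<in> ?U" for g u
      using that z mult[of z g u] mult[of g z u] central[of g] by auto
  qed
  moreover have "?U \<noteq> carrier V" using faithful[OF z(1)] z(2) by blast
  ultimately show ?thesis using v by blast
qed

text \<open>
  The image of \<open>\<rho> z - 1\<close> is an invariant subspace, as \<open>\<rho> z\<close> commutes with the action of \<open>G\<close>.
\<close>
lemma central_difference_surj:
  assumes z: "z \<in> carrier G" "z \<noteq> \<one>\<^bsub>G\<^esub>" and central: "\<And>g. g \<in> carrier G \<Longrightarrow> g \<otimes>\<^bsub>G\<^esub> z = z \<otimes>\<^bsub>G\<^esub> g"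
    and v: "v \<in> carrier V"
  obtains u where "u \<in> carrier V" "v = \<rho> z u \<ominus>\<^bsub>V\<^esub> u"
proof -
  let ?D = "\<lambda>u. \<rho> z u \<ominus>\<^bsub>V\<^esub> u"
  let ?U = "?D ` carrier V"
  have D_add: "?D u \<oplus>\<^bsub>V\<^esub> ?D u' = ?D (u \<oplus>\<^bsub>V\<^esub> u')" if "u \<in> carrier V" "u' \<in> carrier V" for u u'
    using that z by (simp add: V.M.minus_eq V.M.minus_add V.M.a_ac)
  have D_smult: "c \<odot>\<^bsub>V\<^esub> ?D u = ?D (c \<odot>\<^bsub>V\<^esub> u)" if "u \<in> carrier V" for u c
    using that z V.smult_r_distr[of c "\<rho> z u" "\<ominus>\<^bsub>V\<^esub> u"] V.smult_r_minus[of c u]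
    by (simp add: V.M.minus_eq)
  have D_rho: "\<rho> g (?D u) = ?D (\<rho> g u)" if "g \<in> carrier G" "u \<in> carrier V" for g u
    using that z mult[of z g u] mult[of g z u] central[of g] by (simp add: V.M.minus_eq rho_minus)
  have "?U = {\<zero>\<^bsub>V\<^esub>} \<or> ?U = carrier V"
  proof (rule irreducible)
    show "VectorSpace.subspace class_ring ?U V"
    proof (rule subspaceI)
      show "?U \<subseteq> carrier V" using z by auto
      have "?D \<zero>\<^bsub>V\<^esub> = \<zero>\<^bsub>V\<^esub>"
        unfolding rho_zero[OF z(1)] using V.M.minus_eq_zero_iff by blast
      then have "\<zero>\<^bsub>V\<^esub> = ?D \<zero>\<^bsub>V\<^esub>" by (rule sym)
      then show "\<zero>\<^bsub>V\<^esub> \<in> ?U" by blast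
      show "x \<oplus>\<^bsub>V\<^esub> y \<in> ?U" if xy: "x \<in> ?U" "y \<in> ?U" for x y
      proof -
        obtain u u' where "u \<in> carrier V" "x = ?D u" "u' \<in> carrier V" "y = ?D u'"
          using xy by blast
        then show ?thesis using D_add[of u u'] V.M.a_closed by blast
      qed
      show "c \<odot>\<^bsub>V\<^esub> x \<in> ?U" if x: "x \<in> ?U" for c x
      proof -
        obtain u where "u \<in> carrier V" "x = ?D u" using x by blast
        then show ?thesis using D_smult[of u c] V.smult_closed[of c u] by auto
      qed
    qed
    show "\<rho> g x \<in> ?U" if "g \<in> carrier G" "x \<in> ?U" for g x
      using that D_rho by auto
  qed
  moreover have "?U \<noteq> {\<zero>\<^bsub>V\<^esub>}"
  proof
    assume "?U = {\<zero>\<^bsub>V\<^esub>}"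
    then have "?D u = \<zero>\<^bsub>V\<^esub>" if "u \<in> carrier V" for u using that by blast
    then have "\<rho> z u = u" if "u \<in> carrier V" for u
      using that V.M.minus_eq_zero_iff[OF closed[OF z(1) that] that] by blast
    then show False using faithful[OF z(1)] z(2) by blast
  qed
  ultimately show thesis using v that by auto
qed

lemma rho_finsum:
  assumes g: "g \<in> carrier G" and f: "f \<in> {..N :: nat} \<rightarrow> carrier V"
  shows "\<rho> g (\<Oplus>\<^bsub>V\<^esub>i\<in>{..N}. f i) = (\<Oplus>\<^bsub>V\<^esub>i\<in>{..N}. \<rho> g (f i))"
  using f
proof (induction N)
  case 0
  then have "f 0 \<in> carrier V" by auto
  then show ?case using g by (simp add: V.M.finsum_0)
next
  case (Suc N)
  then have f: "f \<in> {..Suc N} \<rightarrow> carrier V" "f \<in> {..N} \<rightarrow> carrier V" "f (Suc N) \<in> carrier V" by auto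
  then have "(\<lambda>i. \<rho> g (f i)) \<in> {..Suc N} \<rightarrow> carrier V" using g by auto
  moreover have "(\<Oplus>\<^bsub>V\<^esub>i\<in>{..N}. f i) \<in> carrier V" using f(2) by (rule V.M.finsum_closed)
  ultimately show ?case using Suc.IH[OF f(2)] g f by (simp add: V.M.finsum_Suc)
qed

end

section \<open>Linear maps between vector spaces\<close>

text \<open>
  A coordinate function with respect to a finite basis.
\<close>
lemma (in vectorspace) nonzero_functional:
  assumes fd: "fin_dim" and nz: "carrier V \<noteq> {\<zero>\<^bsub>V\<^esub>}"
  obtains l where "l \<in> carrier V \<rightarrow> carrier K"
    "\<And>u v. u \<in> carrier V \<Longrightarrow> v \<in> carrier V \<Longrightarrow> l (u \<oplus>\<^bsub>V\<^esub> v) = l u \<oplus>\<^bsub>K\<^esub> l v"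
    "\<And>c v. c \<in> carrier K \<Longrightarrow> v \<in> carrier V \<Longrightarrow> l (c \<odot>\<^bsub>V\<^esub> v) = c \<otimes>\<^bsub>K\<^esub> l v"
    "\<exists>v\<in>carrier V. l v \<noteq> \<zero>\<^bsub>K\<^esub>"
proof -
  obtain \<beta> where \<beta>: "finite \<beta>" "basis \<beta>" using finite_basis_exists[OF fd] by blast
  have \<beta>V: "\<beta> \<subseteq> carrier V" and gen: "span \<beta> = carrier V" using \<beta>(2) by (auto simp: basis_def)
  have "\<beta> \<noteq> {}" using gen nz span_empty by auto
  then obtain b where b: "b \<in> \<beta>" by blast
  have ex1: "\<exists>!x. x \<in> \<beta> \<rightarrow>\<^sub>E carrier K \<and> lincomb x \<beta> = v" if "v \<in> carrier V" for v
    using basis_criterion[OF \<beta>(1) \<beta>V] \<beta>(2) that by blast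
  define co where "co v = (THE x. x \<in> \<beta> \<rightarrow>\<^sub>E carrier K \<and> lincomb x \<beta> = v)" for v
  have co: "co v \<in> \<beta> \<rightarrow>\<^sub>E carrier K" "lincomb (co v) \<beta> = v" if "v \<in> carrier V" for v
    using theI'[OF ex1[OF that]] by (simp_all add: co_def)
  have co_eq: "x w = co (lincomb x \<beta>) w" if "x \<in> \<beta> \<rightarrow> carrier K" "w \<in> \<beta>" for x w
  proof -
    let ?x = "restrict x \<beta>"
    have *: "?x \<in> \<beta> \<rightarrow>\<^sub>E carrier K" using that by auto
    have **: "lincomb ?x \<beta> = lincomb x \<beta>"
      by (rule lincomb_cong[OF refl \<beta>V]) (use that in auto)
    have "lincomb x \<beta> \<in> carrier V" using that \<beta>V by (intro lincomb_closed) auto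
    then have "co (lincomb x \<beta>) = ?x" using ex1 co * ** by blast
    then show ?thesis using that by simp
  qed
  have coK: "co v \<in> \<beta> \<rightarrow> carrier K" if "v \<in> carrier V" for v using co(1)[OF that] by auto
  show thesis
  proof (rule that[of "\<lambda>v. co v b"])
    show "(\<lambda>v. co v b) \<in> carrier V \<rightarrow> carrier K" using coK b by auto
    show "co (u \<oplus>\<^bsub>V\<^esub> v) b = co u b \<oplus>\<^bsub>K\<^esub> co v b" if "u \<in> carrier V" "v \<in> carrier V" for u v
    proof -
      have 1: "lincomb (\<lambda>w. co u w \<oplus>\<^bsub>K\<^esub> co v w) \<beta> = u \<oplus>\<^bsub>V\<^esub> v"
        unfolding lincomb_sum[OF \<beta>(1) \<beta>V coK[OF that(1)] coK[OF that(2)]] co(2)[OF that(1)] co(2)[OF that(2)] ..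
      have 2: "(\<lambda>w. co u w \<oplus>\<^bsub>K\<^esub> co v w) \<in> \<beta> \<rightarrow> carrier K"
        using coK[OF that(1)] coK[OF that(2)] by (auto simp: Pi_iff)
      show ?thesis using co_eq[OF 2 b] unfolding 1 by simp
    qed
    show "co (c \<odot>\<^bsub>V\<^esub> v) b = c \<otimes>\<^bsub>K\<^esub> co v b" if "c \<in> carrier K" "v \<in> carrier V" for c v
    proof -
      have 1: "lincomb (\<lambda>w. c \<otimes>\<^bsub>K\<^esub> co v w) \<beta> = c \<odot>\<^bsub>V\<^esub> v"
        unfolding lincomb_smult[OF \<beta>V coK[OF that(2)] that(1)] co(2)[OF that(2)] ..
      have 2: "(\<lambda>w. c \<otimes>\<^bsub>K\<^esub> co v w) \<in> \<beta> \<rightarrow> carrier K" using coK[OF that(2)] that(1) by auto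
      show ?thesis using co_eq[OF 2 b] unfolding 1 by simp
    qed
    have "(\<lambda>_. \<one>\<^bsub>K\<^esub>) \<in> \<beta> \<rightarrow> carrier K" by auto
    then have "co (lincomb (\<lambda>_. \<one>\<^bsub>K\<^esub>) \<beta>) b = \<one>\<^bsub>K\<^esub>" using co_eq b by metis
    moreover have "lincomb (\<lambda>_. \<one>\<^bsub>K\<^esub>) \<beta> \<in> carrier V" using \<beta>V by (intro lincomb_closed) auto
    ultimately show "\<exists>v\<in>carrier V. co v b \<noteq> \<zero>\<^bsub>K\<^esub>" using one_not_zero by metis
  qed
qed

lemma (in vectorspace) nonzero_linear_map:
  assumes fd: "fin_dim" and nz: "carrier V \<noteq> {\<zero>\<^bsub>V\<^esub>}"
    and W: "vectorspace K W" and nzW: "carrier W \<noteq> {\<zero>\<^bsub>W\<^esub>}"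
  obtains T v where "T \<in> LinearCombinations.module_hom K V W" "v \<in> carrier V" "T v \<noteq> \<zero>\<^bsub>W\<^esub>"
proof -
  interpret W: vectorspace K W by (rule W)
  obtain l where l: "l \<in> carrier V \<rightarrow> carrier K"
    "\<And>u v. u \<in> carrier V \<Longrightarrow> v \<in> carrier V \<Longrightarrow> l (u \<oplus>\<^bsub>V\<^esub> v) = l u \<oplus>\<^bsub>K\<^esub> l v"
    "\<And>c v. c \<in> carrier K \<Longrightarrow> v \<in> carrier V \<Longrightarrow> l (c \<odot>\<^bsub>V\<^esub> v) = c \<otimes>\<^bsub>K\<^esub> l v"
    "\<exists>v\<in>carrier V. l v \<noteq> \<zero>\<^bsub>K\<^esub>"
    using nonzero_functional[OF fd nz] by blast
  obtain v where v: "v \<in> carrier V" "l v \<noteq> \<zero>\<^bsub>K\<^esub>" using l(4) by blast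
  obtain w where w: "w \<in> carrier W" "w \<noteq> \<zero>\<^bsub>W\<^esub>" using nzW W.M.zero_closed by blast
  have lK: "l u \<in> carrier K" if "u \<in> carrier V" for u using l(1) that by auto
  show thesis
  proof (rule that[of "\<lambda>u. l u \<odot>\<^bsub>W\<^esub> w"])
    show "(\<lambda>u. l u \<odot>\<^bsub>W\<^esub> w) \<in> LinearCombinations.module_hom K V W"
      unfolding LinearCombinations.module_hom_def using l(2,3) lK w by (auto simp: W.smult_l_distr W.smult_assoc1)
    show "v \<in> carrier V" by fact
    show "l v \<odot>\<^bsub>W\<^esub> w \<noteq> \<zero>\<^bsub>W\<^esub>"
      using W.mult_inverse[OF lK[OF v(1)] w(1) _ v(2)] w W.smult_r_null
      by (metis Units_inv_closed field_Units Diff_iff lK singletonD v)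
  qed
qed

lemma const_sum_eq_zeroD:
  fixes W :: "('k :: field_char_0, 'w) module"
  assumes W: "vectorspace class_ring W" and w: "w \<in> carrier W"
    and zero: "(\<Oplus>\<^bsub>W\<^esub>i\<in>{..N :: nat}. w) = \<zero>\<^bsub>W\<^esub>"
  shows "w = \<zero>\<^bsub>W\<^esub>"
proof -
  interpret W: vectorspace "class_ring :: 'k ring" W by (rule W)
  have sum: "(\<Oplus>\<^bsub>W\<^esub>i\<in>{..M :: nat}. w) = of_nat (Suc M) \<odot>\<^bsub>W\<^esub> w" for M
  proof (induction M)
    case 0
    then show ?case using w W.smult_one[of w] by (simp add: W.M.finsum_0)
  next
    case (Suc M)
    have "(\<lambda>_. w) \<in> {..Suc M} \<rightarrow> carrier W" using w by auto
    from W.M.finsum_Suc[OF this] have "(\<Oplus>\<^bsub>W\<^esub>i\<in>{..Suc M}. w) = w \<oplus>\<^bsub>W\<^esub> (of_nat (Suc M) \<odot>\<^bsub>W\<^esub> w)"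
      using Suc by simp
    also have "\<dots> = of_nat (Suc (Suc M)) \<odot>\<^bsub>W\<^esub> w"
      using W.smult_l_distr[of 1 "of_nat (Suc M)" w] W.smult_one[of w] w by simp
    finally show ?case .
  qed
  have "(of_nat (Suc N) :: 'k) \<noteq> 0" by (simp del: of_nat_Suc)
  then show ?thesis
    using W.mult_inverse[of "of_nat (Suc N)" w "\<zero>\<^bsub>W\<^esub>"] sum[of N] zero w W.smult_r_null by simp
qed

section \<open>Fourier averages of linear maps\<close>

locale irrep_pair = ANC_cyclic G a s + R: faithful_irrep V G \<rho> + S: faithful_irrep W G \<sigma>
  for G :: "('a, 'b) monoid_scheme" (structure) and a s
    and V :: "('k :: field_char_0, 'v) module" and \<rho> and W :: "('k, 'w) module" and \<sigma>
begin

text \<open>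
  Pass to a central nontrivial power of \<open>x\<close>.
\<close>
lemma A_fixed_vector_zero:
  assumes x: "x \<in> A" "x \<noteq> \<one>" and w: "w \<in> carrier W" "\<sigma> x w = w"
  shows "w = \<zero>\<^bsub>W\<^esub>"
proof -
  obtain j :: nat where j: "x [^] j \<noteq> \<one>" "\<And>g. g \<in> carrier G \<Longrightarrow> g \<otimes> x [^] j = x [^] j \<otimes> g"
    using central_nontrivial_power[OF x] by blast
  have xc: "x \<in> carrier G" using A_closed[OF x(1)] .
  have "\<sigma> (x [^] i) w = w" for i :: nat
    by (induction i) (use w xc in \<open>simp_all add: S.one S.mult\<close>)
  then show ?thesis using S.central_fixed_vector_zero[OF _ j w(1)] xc by simp
qed

text \<open>
  The sum over a full period is fixed by \<open>x\<close>.
\<close>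
lemma A_orbit_sum_zero:
  assumes x: "x \<in> A" "x \<noteq> \<one>" "x [^] Suc N = \<one>" and w: "w \<in> carrier W"
  shows "(\<Oplus>\<^bsub>W\<^esub>k\<in>{..N}. \<sigma> (x [^] k) w) = \<zero>\<^bsub>W\<^esub>"
proof (rule A_fixed_vector_zero[OF x(1,2)])
  have xc: "x \<in> carrier G" using A_closed[OF x(1)] .
  let ?f = "\<lambda>k. \<sigma> (x [^] k) w"
  have f: "?f \<in> {..M} \<rightarrow> carrier W" for M :: nat using w xc by auto
  show "(\<Oplus>\<^bsub>W\<^esub>k\<in>{..N}. ?f k) \<in> carrier W" using f by (rule S.V.M.finsum_closed)
  have "\<sigma> x (\<Oplus>\<^bsub>W\<^esub>k\<in>{..N}. ?f k) = (\<Oplus>\<^bsub>W\<^esub>k\<in>{..N}. \<sigma> x (?f k))"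
    by (rule S.rho_finsum[OF xc f])
  also have "\<dots> = (\<Oplus>\<^bsub>W\<^esub>k\<in>{..N}. ?f (Suc k))"
  proof (rule S.V.M.finsum_cong')
    show "\<sigma> x (?f k) = ?f (Suc k)" for k
      using S.mult[OF xc, of "x [^] k" w] nat_pow_Suc2[OF xc, of k] w xc by (simp del: nat_pow_Suc)
  qed (use w xc in auto)
  also have "\<dots> = (\<Oplus>\<^bsub>W\<^esub>k\<in>{..N}. ?f k)"
    by (rule S.V.M.finsum_shift[OF f]) (use x(3) in simp)
  finally show "\<sigma> x (\<Oplus>\<^bsub>W\<^esub>k\<in>{..N}. ?f k) = (\<Oplus>\<^bsub>W\<^esub>k\<in>{..N}. ?f k)" .
qed

text \<open>
  Up to the factor \<open>1/n\<close>, the projection of \<open>T\<close> to the linear maps that intertwine \<open>a\<close> on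
  \<open>V\<close> with \<open>a\<^sup>k\<close> on \<open>W\<close>. The operator \<open>\<sigma> a\<close> replaces a primitive \<open>n\<close>-th root of unity, which
  \<open>K\<close> need not contain.
\<close>
definition twisted_average :: "('v \<Rightarrow> 'w) \<Rightarrow> nat \<Rightarrow> 'v \<Rightarrow> 'w" where
  "twisted_average T k v =
     (\<Oplus>\<^bsub>W\<^esub>i\<in>{..ord a - 1}. \<sigma> (a [^] (- int k * int i)) (T (\<rho> (a [^] int i) v)))"

context
  fixes T assumes T: "T \<in> LinearCombinations.module_hom class_ring V W"
begin

lemma T_closed [simp, intro]: "v \<in> carrier V \<Longrightarrow> T v \<in> carrier W"
  using LinearCombinations.module_hom_closed[OF T] by auto

lemma T_add: "u \<in> carrier V \<Longrightarrow> v \<in> carrier V \<Longrightarrow> T (u \<oplus>\<^bsub>V\<^esub> v) = T u \<oplus>\<^bsub>W\<^esub> T v"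
  using LinearCombinations.module_hom_add[OF T] .

lemma T_smult: "v \<in> carrier V \<Longrightarrow> T (c \<odot>\<^bsub>V\<^esub> v) = c \<odot>\<^bsub>W\<^esub> T v"
  using LinearCombinations.module_hom_smult[OF T] by simp

lemma T_zero: "T \<zero>\<^bsub>V\<^esub> = \<zero>\<^bsub>W\<^esub>"
  using T_smult[of "\<zero>\<^bsub>V\<^esub>" 0] R.V.lmult_0 S.V.lmult_0[OF T_closed, of "\<zero>\<^bsub>V\<^esub>"] by simp

lemma Suc_ord: "Suc (ord a - 1) = ord a"
  using n_pos by simp

lemma twisted_average_hom: "twisted_average T k \<in> LinearCombinations.module_hom class_ring V W"
proof -
  let ?t = "\<lambda>v i. \<sigma> (a [^] (- int k * int i)) (T (\<rho> (a [^] int i) v))"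
  have c: "?t v \<in> {..M} \<rightarrow> carrier W" if "v \<in> carrier V" for v and M :: nat
    using that by auto
  have smult_sum: "(\<Oplus>\<^bsub>W\<^esub>i\<in>{..M}. c \<odot>\<^bsub>W\<^esub> ?t v i) = c \<odot>\<^bsub>W\<^esub> (\<Oplus>\<^bsub>W\<^esub>i\<in>{..M}. ?t v i)"
    if v: "v \<in> carrier V" for c v and M :: nat
    using S.V.finsum_smult_ldistr[of "{..M}" c "?t v"] c[OF v] by auto
  show ?thesis
    unfolding LinearCombinations.module_hom_def twisted_average_def
  proof (intro CollectI conjI allI impI; (elim conjE)?)
    show "(\<lambda>v. \<Oplus>\<^bsub>W\<^esub>i\<in>{..ord a - 1}. ?t v i) \<in> carrier V \<rightarrow> carrier W"
      using S.V.M.finsum_closed[OF c] by auto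
    fix u v assume uv: "u \<in> carrier V" "v \<in> carrier V"
    have "(\<Oplus>\<^bsub>W\<^esub>i\<in>{..ord a - 1}. ?t (u \<oplus>\<^bsub>V\<^esub> v) i) = (\<Oplus>\<^bsub>W\<^esub>i\<in>{..ord a - 1}. ?t u i \<oplus>\<^bsub>W\<^esub> ?t v i)"
      by (rule S.V.M.finsum_cong') (use uv in \<open>auto simp: T_add\<close>)
    then show "(\<Oplus>\<^bsub>W\<^esub>i\<in>{..ord a - 1}. ?t (u \<oplus>\<^bsub>V\<^esub> v) i)
        = (\<Oplus>\<^bsub>W\<^esub>i\<in>{..ord a - 1}. ?t u i) \<oplus>\<^bsub>W\<^esub> (\<Oplus>\<^bsub>W\<^esub>i\<in>{..ord a - 1}. ?t v i)"
      using S.V.M.finsum_addf[OF c[OF uv(1)] c[OF uv(2)]] by simp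
  next
    fix c :: 'k and v assume v: "v \<in> carrier V"
    have "(\<Oplus>\<^bsub>W\<^esub>i\<in>{..ord a - 1}. ?t (c \<odot>\<^bsub>V\<^esub> v) i) = (\<Oplus>\<^bsub>W\<^esub>i\<in>{..ord a - 1}. c \<odot>\<^bsub>W\<^esub> ?t v i)"
      by (rule S.V.M.finsum_cong') (use v in \<open>auto simp: T_smult intro: S.V.smult_closed\<close>)
    then show "(\<Oplus>\<^bsub>W\<^esub>i\<in>{..ord a - 1}. ?t (c \<odot>\<^bsub>V\<^esub> v) i) = c \<odot>\<^bsub>W\<^esub> (\<Oplus>\<^bsub>W\<^esub>i\<in>{..ord a - 1}. ?t v i)"
      using smult_sum[OF v] by simp
  qed
qed

lemma twisted_average_equivariant:
  assumes v: "v \<in> carrier V"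
  shows "twisted_average T k (\<rho> a v) = \<sigma> (a [^] k) (twisted_average T k v)"
proof -
  let ?t = "\<lambda>i. \<sigma> (a [^] (- int k * int i)) (T (\<rho> (a [^] int i) v))"
  have t: "?t \<in> {..M} \<rightarrow> carrier W" for M :: nat using v by auto
  have "twisted_average T k (\<rho> a v) = (\<Oplus>\<^bsub>W\<^esub>i\<in>{..ord a - 1}. \<sigma> (a [^] k) (?t (Suc i)))"
    unfolding twisted_average_def
  proof (rule S.V.M.finsum_cong')
    fix i
    have "a [^] k \<otimes> a [^] (- int k * int (Suc i)) = a [^] (- int k * int i)"
      by (simp add: algebra_simps flip: int_pow_int int_pow_mult)
    moreover have "a [^] int i \<otimes> a = a [^] int (Suc i)"
      using int_pow_mult[of a "int i" 1] by (simp add: add.commute)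
    ultimately show "\<sigma> (a [^] (- int k * int i)) (T (\<rho> (a [^] int i) (\<rho> a v))) = \<sigma> (a [^] k) (?t (Suc i))"
      using v S.mult[of "a [^] k" "a [^] (- int k * int (Suc i))" "T (\<rho> (a [^] int (Suc i)) v)"]
        R.mult[of "a [^] int i" a v] by simp
  qed (use v in auto)
  also have "\<dots> = \<sigma> (a [^] k) (\<Oplus>\<^bsub>W\<^esub>i\<in>{..ord a - 1}. ?t (Suc i))"
    by (rule S.rho_finsum[symmetric]) (use v in auto)
  also have "(\<Oplus>\<^bsub>W\<^esub>i\<in>{..ord a - 1}. ?t (Suc i)) = (\<Oplus>\<^bsub>W\<^esub>i\<in>{..ord a - 1}. ?t i)"
  proof (rule S.V.M.finsum_shift[OF t])
    have "a [^] (- int k * n) = \<one>" "a [^] n = \<one>" by (simp_all add: a_pow_eq_one_iff del: int_pow_int)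
    then show "?t (Suc (ord a - 1)) = ?t 0" unfolding Suc_ord by simp
  qed
  finally show ?thesis unfolding twisted_average_def .
qed

text \<open>
  Fourier inversion: summed over \<open>k\<close>, the averages give \<open>n T\<close>, since the terms with
  \<open>i \<noteq> 0\<close> are sums over the orbit of a nontrivial element of \<open>A\<close> and vanish.
\<close>
lemma some_twisted_average_nonzero:
  assumes v: "v \<in> carrier V" "T v \<noteq> \<zero>\<^bsub>W\<^esub>"
  shows "\<exists>k. twisted_average T k v \<noteq> \<zero>\<^bsub>W\<^esub>"
proof (rule ccontr)
  assume "\<not> (\<exists>k. twisted_average T k v \<noteq> \<zero>\<^bsub>W\<^esub>)"
  then have z: "twisted_average T k v = \<zero>\<^bsub>W\<^esub>" for k by blast
  let ?N = "ord a - 1"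
  let ?t = "\<lambda>k i. \<sigma> (a [^] (- int k * int i)) (T (\<rho> (a [^] int i) v))"
  have t: "?t k i \<in> carrier W" for k i using v by auto
  have col: "(\<Oplus>\<^bsub>W\<^esub>k\<in>{..?N}. ?t k i) = (if i = 0 then \<Oplus>\<^bsub>W\<^esub>k\<in>{..?N}. T v else \<zero>\<^bsub>W\<^esub>)" if i: "i \<le> ?N" for i
  proof (cases "i = 0")
    case True
    then show ?thesis using v by (simp add: S.one R.one)
  next
    case False
    let ?x = "a [^] (- int i)"
    have pow: "?x [^] k = a [^] (- int k * int i)" for k :: nat
      by (simp add: int_pow_pow mult.commute flip: int_pow_int)
    have "?x \<noteq> \<one>" using False i n_pos by (auto simp: a_pow_eq_one_iff dest: dvd_imp_le)
    moreover have "?x [^] Suc ?N = \<one>" unfolding Suc_ord pow by (simp add: a_pow_eq_one_iff)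
    ultimately have "(\<Oplus>\<^bsub>W\<^esub>k\<in>{..?N}. \<sigma> (?x [^] k) (T (\<rho> (a [^] int i) v))) = \<zero>\<^bsub>W\<^esub>"
      using v by (intro A_orbit_sum_zero) auto
    then show ?thesis using False by (simp only: pow if_False)
  qed
  have "\<zero>\<^bsub>W\<^esub> = (\<Oplus>\<^bsub>W\<^esub>k\<in>{..?N}. twisted_average T k v)"
    unfolding z by simp
  also have "\<dots> = (\<Oplus>\<^bsub>W\<^esub>i\<in>{..?N}. \<Oplus>\<^bsub>W\<^esub>k\<in>{..?N}. ?t k i)"
    unfolding twisted_average_def by (rule S.V.M.finsum_swap_atMost) (rule t)
  also have "\<dots> = (\<Oplus>\<^bsub>W\<^esub>i\<in>{..?N}. if 0 = i then \<Oplus>\<^bsub>W\<^esub>k\<in>{..?N}. T v else \<zero>\<^bsub>W\<^esub>)"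
    by (rule S.V.M.finsum_cong') (use v col in \<open>auto intro!: S.V.M.finsum_closed\<close>)
  also have "\<dots> = (\<Oplus>\<^bsub>W\<^esub>k\<in>{..?N}. T v)"
    by (rule S.V.M.finsum_singleton) (use v in \<open>auto intro!: S.V.M.finsum_closed\<close>)
  finally have "T v = \<zero>\<^bsub>W\<^esub>"
    using const_sum_eq_zeroD[OF S.V.vectorspace_axioms T_closed[OF v(1)], of ?N] by metis
  then show False using v by simp
qed

end

end

section \<open>Equivalence up to an automorphism\<close>

lemma module_homI:
  assumes "\<And>v. v \<in> carrier M \<Longrightarrow> f v \<in> carrier N"
    "\<And>u v. u \<in> carrier M \<Longrightarrow> v \<in> carrier M \<Longrightarrow> f (u \<oplus>\<^bsub>M\<^esub> v) = f u \<oplus>\<^bsub>N\<^esub> f v"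
    "\<And>c v. v \<in> carrier M \<Longrightarrow> f (c \<odot>\<^bsub>M\<^esub> v) = c \<odot>\<^bsub>N\<^esub> f v"
  shows "f \<in> LinearCombinations.module_hom class_ring M N"
  using assms by (simp add: LinearCombinations.module_hom_def)

context irrep_pair
begin

lemma equivariant_nat_pow:
  assumes T: "T \<in> LinearCombinations.module_hom class_ring V W" and b: "b \<in> carrier G"
    and eq: "\<And>v. v \<in> carrier V \<Longrightarrow> T (\<rho> a v) = \<sigma> b (T v)" and v: "v \<in> carrier V"
  shows "T (\<rho> (a [^] (i :: nat)) v) = \<sigma> (b [^] i) (T v)"
proof -
  note Tc = T_closed[OF T]
  show ?thesis
  proof (induction i)
    case 0
    show ?case using v Tc by (simp add: R.one S.one)
  next
    case (Suc i)
    have "T (\<rho> (a [^] Suc i) v) = T (\<rho> a (\<rho> (a [^] i) v))"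
      using R.mult[of a "a [^] i" v] nat_pow_Suc2[of a i] v by (simp del: nat_pow_Suc)
    also have "\<dots> = \<sigma> b (\<sigma> (b [^] i) (T v))" using v eq Suc by simp
    also have "\<dots> = \<sigma> (b [^] Suc i) (T v)"
      using S.mult[of b "b [^] i" "T v"] nat_pow_Suc2[of b i] v b Tc by (simp del: nat_pow_Suc)
    finally show ?case .
  qed
qed

text \<open>
  If a prime \<open>p\<close> divided \<open>k\<close> and \<open>n\<close>, then \<open>T\<close> would kill the image of
  \<open>\<rho> z - 1\<close> for the central element \<open>z = a\<^bsup>n/p\<^esup>\<close>, and this image is all of \<open>V\<close>.
\<close>
lemma coprime_twisting_exponent:
  assumes T: "T \<in> LinearCombinations.module_hom class_ring V W"
    and eq: "\<And>v. v \<in> carrier V \<Longrightarrow> T (\<rho> a v) = \<sigma> (a [^] (k :: nat)) (T v)"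
    and v: "v \<in> carrier V" "T v \<noteq> \<zero>\<^bsub>W\<^esub>"
  shows "coprime k (ord a)"
proof (rule ccontr)
  assume "\<not> coprime k (ord a)"
  then have "gcd k (ord a) \<noteq> 1" by (simp add: coprime_iff_gcd_eq_1)
  then obtain p where p: "prime p" "p dvd k" "p dvd ord a"
    using prime_factor_nat by (metis gcd_nat.bounded_iff)
  obtain m where m: "ord a = p * m" using p(3) by (auto elim: dvdE)
  obtain l where l: "k = p * l" using p(2) by (auto elim: dvdE)
  let ?z = "a [^] m"
  have m0: "m > 0" using m n_pos by (cases m) auto
  have zc: "?z \<in> carrier G" by simp
  have z1: "?z \<noteq> \<one>" using m m0 prime_gt_1_nat[OF p(1)] by (auto simp: pow_eq_id dest: dvd_imp_le)
  have zz: "?z = a [^] (n div int p * 1)"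
    using m prime_gt_0_nat[OF p(1)] by (simp add: int_pow_int flip: zdiv_int)
  have central: "g \<otimes> ?z = ?z \<otimes> g" if "g \<in> carrier G" for g
    unfolding zz by (rule prime_order_elt_central[OF _ _ that]) (use p in simp_all)
  obtain u where u: "u \<in> carrier V" "v = \<rho> ?z u \<ominus>\<^bsub>V\<^esub> u"
    using R.central_difference_surj[OF zc z1 central v(1)] by blast
  have "T (\<rho> ?z u) = \<sigma> ((a [^] k) [^] m) (T u)"
    by (rule equivariant_nat_pow[OF T _ eq u(1)]) auto
  also have "(a [^] k) [^] m = \<one>"
    by (simp add: nat_pow_pow pow_eq_id m l)
  finally have Tz: "T (\<rho> ?z u) = T u" using u T_closed[OF T] by (simp add: S.one)
  have "\<rho> ?z u = v \<oplus>\<^bsub>V\<^esub> u" using u zc by (simp add: R.V.M.minus_eq R.V.M.a_assoc R.V.M.l_neg)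
  then have "T u = T v \<oplus>\<^bsub>W\<^esub> T u" using Tz T_add[OF T v(1) u(1)] by simp
  then have "T v = \<zero>\<^bsub>W\<^esub>"
    using v(1) u(1) T_closed[OF T] by (metis S.V.M.add.r_cancel_one')
  then show False using v by simp
qed

lemma twisted_A_hom_exists:
  assumes fd: "R.V.fin_dim"
  obtains k T v where "coprime (int k) n" "T \<in> LinearCombinations.module_hom class_ring V W"
    "v \<in> carrier V" "T v \<noteq> \<zero>\<^bsub>W\<^esub>"
    "\<And>v. v \<in> carrier V \<Longrightarrow> T (\<rho> a v) = \<sigma> (a [^] int k) (T v)"
proof -
  obtain T v where T: "T \<in> LinearCombinations.module_hom class_ring V W"
    and v: "v \<in> carrier V" "T v \<noteq> \<zero>\<^bsub>W\<^esub>"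
    using R.V.nonzero_linear_map[OF fd R.nontrivial S.V.vectorspace_axioms S.nontrivial] by blast
  obtain k where k: "twisted_average T k v \<noteq> \<zero>\<^bsub>W\<^esub>"
    using some_twisted_average_nonzero[OF T v] by blast
  note hom = twisted_average_hom[OF T, of k]
  have eq: "twisted_average T k (\<rho> a v) = \<sigma> (a [^] k) (twisted_average T k v)" if "v \<in> carrier V" for v
    by (rule twisted_average_equivariant[OF T that])
  have "coprime k (ord a)" by (rule coprime_twisting_exponent[OF hom eq v(1) k])
  then show thesis using that[OF _ hom v(1) k] eq by (simp add: int_pow_int)
qed

text \<open>
  The action of \<open>x\<close> on linear maps by conjugation.
\<close>
definition conj_map :: "('v \<Rightarrow> 'w) \<Rightarrow> 'a \<Rightarrow> 'v \<Rightarrow> 'w" where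
  "conj_map T x v = \<sigma> x (T (\<rho> (inv x) v))"

context
  fixes T
  assumes T: "T \<in> LinearCombinations.module_hom class_ring V W"
    and A_hom: "\<And>v. v \<in> carrier V \<Longrightarrow> T (\<rho> a v) = \<sigma> a (T v)"
begin

lemma A_equivariant: 
  assumes x: "x \<in> A" and v: "v \<in> carrier V"
  shows "T (\<rho> x v) = \<sigma> x (T v)"
proof -
  obtain i where i: "x = a [^] (i :: int)" using x by (auto simp: A_def)
  have "[i = int (nat (i mod n))] (mod n)" using n_pos by (simp add: cong_def)
  then have "x = a [^] nat (i mod n)" unfolding i by (simp only: a_pow_eq_iff[symmetric] int_pow_int)
  then show ?thesis using equivariant_nat_pow[OF T a_closed A_hom v] by simp
qed

lemma conj_map_closed [simp, intro]: "x \<in> carrier G \<Longrightarrow> v \<in> carrier V \<Longrightarrow> conj_map T x v \<in> carrier W"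
  using T_closed[OF T] by (simp add: conj_map_def)

text \<open>
  For a map that commutes with \<open>A\<close>, the conjugate by \<open>x\<close> depends only on the coset of \<open>x\<close>.
\<close>
lemma conj_map_coset:
  assumes x: "x \<in> carrier G" and c: "c \<in> A" and v: "v \<in> carrier V"
  shows "conj_map T (x \<otimes> c) v = conj_map T x v"
proof -
  have cc: "c \<in> carrier G" using A_closed[OF c] .
  let ?u = "\<rho> (inv x) v"
  have u: "?u \<in> carrier V" using x v by simp
  have "conj_map T (x \<otimes> c) v = \<sigma> x (\<sigma> c (T (\<rho> (inv c) ?u)))"
    using x cc v T_closed[OF T] by (simp add: conj_map_def inv_mult_group R.mult S.mult)
  also have "\<sigma> c (T (\<rho> (inv c) ?u)) = T (\<rho> c (\<rho> (inv c) ?u))"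
    using A_equivariant[OF c, of "\<rho> (inv c) ?u"] cc u by simp
  also have "\<dots> = T ?u" using R.rho_inv_cancel[OF cc u] by simp
  finally show ?thesis by (simp add: conj_map_def)
qed

lemma conj_map_one: "v \<in> carrier V \<Longrightarrow> conj_map T \<one> v = T v"
  using T_closed[OF T] by (simp add: conj_map_def R.one S.one)

lemma conj_map_mult:
  assumes "x \<in> carrier G" "y \<in> carrier G" "v \<in> carrier V"
  shows "\<sigma> x (conj_map T y (\<rho> (inv x) v)) = conj_map T (x \<otimes> y) v"
  using assms T_closed[OF T] by (simp add: conj_map_def inv_mult_group R.mult S.mult)

lemma conj_map_A: "x \<in> A \<Longrightarrow> v \<in> carrier V \<Longrightarrow> conj_map T x v = T v"
  using conj_map_coset[of \<one> x v] conj_map_one A_closed by simp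

text \<open>
  \<open>A\<close> has the two cosets of 1 and \<open>g\<close>, which left translation by \<open>x\<close> permutes.
\<close>
lemma coset_sum_invariant:
  assumes g: "g \<in> carrier G" "g \<notin> A" and x: "x \<in> carrier G" and v: "v \<in> carrier V"
  shows "\<sigma> x (T (\<rho> (inv x) v) \<oplus>\<^bsub>W\<^esub> conj_map T g (\<rho> (inv x) v)) = T v \<oplus>\<^bsub>W\<^esub> conj_map T g v"
proof -
  have "\<sigma> x (T (\<rho> (inv x) v) \<oplus>\<^bsub>W\<^esub> conj_map T g (\<rho> (inv x) v))
      = conj_map T x v \<oplus>\<^bsub>W\<^esub> conj_map T (x \<otimes> g) v"
    using g x v T_closed[OF T] conj_map_mult[OF x g(1) v] by (simp add: conj_map_def[of T x])
  also have "\<dots> = T v \<oplus>\<^bsub>W\<^esub> conj_map T g v"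
  proof (cases "x \<in> A")
    case True
    have "inv g \<otimes> x \<otimes> g \<in> A"
      using conj_a_pow[of "inv g"] True g by (auto simp: A_def)
    moreover have "x \<otimes> g = g \<otimes> (inv g \<otimes> x \<otimes> g)" using x g by (simp add: m_assoc inv_cancel)
    ultimately have "conj_map T (x \<otimes> g) v = conj_map T g v" using conj_map_coset[OF g(1) _ v] by simp
    then show ?thesis using conj_map_A[OF True v] by simp
  next
    case False
    have "inv g \<notin> A" using g subgroup.m_inv_closed[OF A_subgroup] by fastforce
    then have "inv g \<otimes> x \<in> A" using mult_outside_A[OF _ _ x False] g by simp
    moreover have "x = g \<otimes> (inv g \<otimes> x)" using x g by (simp add: inv_cancel)
    ultimately have "conj_map T x v = conj_map T g v" using conj_map_coset[OF g(1) _ v] by metis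
    moreover have "conj_map T (x \<otimes> g) v = T v" using conj_map_A[OF mult_outside_A[OF x False g] v] .
    ultimately show ?thesis using g x v T_closed[OF T] by (simp add: S.V.M.a_comm)
  qed
  finally show ?thesis .
qed

end

lemma equivariantI:
  assumes S: "\<And>v. v \<in> carrier V \<Longrightarrow> S v \<in> carrier W"
    and inv: "\<And>x v. x \<in> carrier G \<Longrightarrow> v \<in> carrier V \<Longrightarrow> \<sigma> x (S (\<rho> (inv x) v)) = S v"
    and x: "x \<in> carrier G" and v: "v \<in> carrier V"
  shows "S (\<rho> x v) = \<sigma> x (S v)"
  using inv[OF x, of "\<rho> x v"] R.rho_inv_cancel(2)[OF x v] x v by simp

text \<open>
  Sum the conjugates of \<open>T\<close>, or those of \<open>T \<circ> \<rho> a\<close>, over the cosets of \<open>A\<close>. Artin's argument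
  for the independence of characters shows that one of the sums is nonzero: if both vanish,
  comparing them gives \<open>\<sigma> a (T v) = \<sigma> (a\<^bsup>s g\<^esup>) (T v)\<close>, so a nontrivial element of \<open>A\<close>
  fixes \<open>T v\<close>.
\<close>
lemma equivariant_hom_exists:
  assumes T: "T \<in> LinearCombinations.module_hom class_ring V W"
    and A_hom: "\<And>v. v \<in> carrier V \<Longrightarrow> T (\<rho> a v) = \<sigma> a (T v)"
    and nz: "v \<in> carrier V" "T v \<noteq> \<zero>\<^bsub>W\<^esub>"
  obtains S u where "S \<in> LinearCombinations.module_hom class_ring V W" "u \<in> carrier V" "S u \<noteq> \<zero>\<^bsub>W\<^esub>"
    "\<And>x v. x \<in> carrier G \<Longrightarrow> v \<in> carrier V \<Longrightarrow> S (\<rho> x v) = \<sigma> x (S v)"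
proof (cases "carrier G \<subseteq> A")
  case True
  then show thesis using that[OF T nz] A_equivariant[OF T A_hom] by blast
next
  case False
  then obtain g where g: "g \<in> carrier G" "g \<notin> A" by blast
  let ?T' = "\<lambda>v. T (\<rho> a v)"
  let ?S = "\<lambda>T v. T v \<oplus>\<^bsub>W\<^esub> conj_map T g v"
  have T': "?T' \<in> LinearCombinations.module_hom class_ring V W"
    by (rule module_homI) (simp_all add: T_closed[OF T] T_add[OF T] T_smult[OF T])
  have A_hom2: "?T' (\<rho> a v) = \<sigma> a (?T' v)" if "v \<in> carrier V" for v
    using A_hom[of "\<rho> a v"] that by simp
  have S_hom: "?S T \<in> LinearCombinations.module_hom class_ring V W"
    if "T \<in> LinearCombinations.module_hom class_ring V W" for T
    by (rule module_homI) (use g in \<open>simp_all add: T_closed[OF that] T_add[OF that] T_smult[OF that]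
      conj_map_def S.V.M.a_ac S.V.smult_r_distr\<close>)
  have S_eq: "?S T (\<rho> x v) = \<sigma> x (?S T v)"
    if T: "T \<in> LinearCombinations.module_hom class_ring V W"
      "\<And>v. v \<in> carrier V \<Longrightarrow> T (\<rho> a v) = \<sigma> a (T v)" and xv: "x \<in> carrier G" "v \<in> carrier V" for T x v
    by (rule equivariantI[OF _ _ xv])
      (use T_closed[OF T(1)] conj_map_closed[OF T] coset_sum_invariant[OF T g] g in auto)
  have "(\<exists>u\<in>carrier V. ?S T u \<noteq> \<zero>\<^bsub>W\<^esub>) \<or> (\<exists>u\<in>carrier V. ?S ?T' u \<noteq> \<zero>\<^bsub>W\<^esub>)"
  proof (rule ccontr)
    assume "\<not> ?thesis"
    then have z: "\<And>u. u \<in> carrier V \<Longrightarrow> ?S T u = \<zero>\<^bsub>W\<^esub>"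
      and z': "\<And>u. u \<in> carrier V \<Longrightarrow> ?S ?T' u = \<zero>\<^bsub>W\<^esub>" by auto
    let ?c = "a [^] s g"
    let ?w = "\<rho> ?c v"
    have w: "?w \<in> carrier V" using nz by simp
    have "a \<otimes> inv g = inv g \<otimes> ?c"
      using conj_a[OF g(1)] g(1) by (simp add: m_assoc inv_cancel flip: conj_a)
    then have "\<rho> a (\<rho> (inv g) v) = \<rho> (inv g) ?w"
      using R.mult[of a "inv g" v] R.mult[of "inv g" ?c v] g nz by simp
    then have "conj_map ?T' g v = conj_map T g ?w" by (simp add: conj_map_def)
    then have "T (\<rho> a v) \<oplus>\<^bsub>W\<^esub> conj_map T g ?w = T ?w \<oplus>\<^bsub>W\<^esub> conj_map T g ?w"
      using z[OF w] z'[OF nz(1)] by simp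
    then have "T (\<rho> a v) = T ?w"
      using nz w g T_closed[OF T] conj_map_closed[OF T A_hom g(1) w] by simp
    then have "\<sigma> a (T v) = \<sigma> ?c (T v)"
      using A_hom[OF nz(1)] A_equivariant[OF T A_hom, of ?c v] nz by simp
    moreover have "?c = a \<otimes> a [^] (s g - 1)"
      using int_pow_mult[of a 1 "s g - 1"] by simp
    moreover have Tv: "T v \<in> carrier W" using T_closed[OF T] nz by simp
    ultimately have "\<sigma> (inv a) (\<sigma> a (T v)) = \<sigma> (inv a) (\<sigma> a (\<sigma> (a [^] (s g - 1)) (T v)))"
      using S.mult[of a "a [^] (s g - 1)" "T v"] by simp
    then have "T v = \<sigma> (a [^] (s g - 1)) (T v)"
      using Tv by (simp add: S.rho_inv_cancel)
    moreover have "a [^] (s g - 1) \<noteq> \<one>"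
      unfolding a_pow_eq_one_iff using mem_A_iff[OF g(1)] g(2) by blast
    ultimately have "T v = \<zero>\<^bsub>W\<^esub>" using A_fixed_vector_zero[OF a_pow_in_A _ Tv] by metis
    then show False using nz by simp
  qed
  then show thesis
    using that[OF S_hom[OF T] _ _ S_eq[OF T A_hom]] that[OF S_hom[OF T'] _ _ S_eq[OF T' A_hom2]] by blast
qed

text \<open>
  Schur: the kernel and the image are invariant subspaces.
\<close>
lemma equivariant_hom_bij:
  assumes S: "S \<in> LinearCombinations.module_hom class_ring V W"
    and eq: "\<And>x v. x \<in> carrier G \<Longrightarrow> v \<in> carrier V \<Longrightarrow> S (\<rho> x v) = \<sigma> x (S v)"
    and nz: "u \<in> carrier V" "S u \<noteq> \<zero>\<^bsub>W\<^esub>"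
  shows "bij_betw S (carrier V) (carrier W)"
proof -
  note Sc = T_closed[OF S] and Sadd = T_add[OF S] and Ssmult = T_smult[OF S] and S0 = T_zero[OF S]
  let ?K = "{v \<in> carrier V. S v = \<zero>\<^bsub>W\<^esub>}"
  have "?K = {\<zero>\<^bsub>V\<^esub>} \<or> ?K = carrier V"
  proof (rule R.irreducible)
    show "VectorSpace.subspace class_ring ?K V"
      by (rule R.subspaceI) (auto simp: S0 Sadd Ssmult S.V.smult_r_null intro: R.V.smult_closed)
  qed (auto simp: eq)
  then have K: "?K = {\<zero>\<^bsub>V\<^esub>}" using nz by blast
  have "inj_on S (carrier V)"
  proof (rule inj_onI)
    fix x y assume xy: "x \<in> carrier V" "y \<in> carrier V" "S x = S y"
    have "S (\<ominus>\<^bsub>V\<^esub> y) = \<ominus>\<^bsub>W\<^esub> S y"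
      using Ssmult[of y "- 1"] R.V.smult_minus_1[of y] S.V.smult_minus_1[of "S y"] xy Sc
      by (simp add: class_ring_simps)
    then have "S (x \<ominus>\<^bsub>V\<^esub> y) = \<zero>\<^bsub>W\<^esub>"
      using xy Sc by (simp add: R.V.M.minus_eq Sadd S.V.M.r_neg)
    then have "x \<ominus>\<^bsub>V\<^esub> y \<in> ?K" using xy by simp
    then show "x = y" using K R.V.M.minus_eq_zero_iff xy by blast
  qed
  moreover have "S ` carrier V = {\<zero>\<^bsub>W\<^esub>} \<or> S ` carrier V = carrier W"
  proof (rule S.irreducible)
    show "VectorSpace.subspace class_ring (S ` carrier V) W"
    proof (rule S.subspaceI)
      show "S ` carrier V \<subseteq> carrier W" using Sc by auto
      show "\<zero>\<^bsub>W\<^esub> \<in> S ` carrier V" using S0 by (metis imageI R.V.M.zero_closed)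
      show "x \<oplus>\<^bsub>W\<^esub> y \<in> S ` carrier V" if "x \<in> S ` carrier V" "y \<in> S ` carrier V" for x y
        using that by (auto simp flip: Sadd)
      show "c \<odot>\<^bsub>W\<^esub> x \<in> S ` carrier V" if "x \<in> S ` carrier V" for c x
        using that R.V.smult_closed by (auto simp flip: Ssmult)
    qed
    show "\<sigma> g w \<in> S ` carrier V" if "g \<in> carrier G" "w \<in> S ` carrier V" for g w
      using that by (auto simp flip: eq)
  qed
  then have "S ` carrier V = carrier W" using nz by blast
  ultimately show ?thesis by (simp add: bij_betw_def)
qed

end

lemma (in faithful_irrep) twist:
  assumes fin: "finite (carrier G)" and \<alpha>: "\<alpha> \<in> hom G G" "inj_on \<alpha> (carrier G)"
  shows "faithful_irrep V G (\<lambda>g. \<rho> (\<alpha> g))"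
proof -
  have c: "\<alpha> g \<in> carrier G" if "g \<in> carrier G" for g using \<alpha>(1) that by (rule hom_in_carrier)
  have surj: "\<alpha> ` carrier G = carrier G"
    by (rule endo_inj_surj[OF fin _ \<alpha>(2)]) (use c in auto)
  have one': "\<alpha> \<one>\<^bsub>G\<^esub> = \<one>\<^bsub>G\<^esub>" using hom_one[OF \<alpha>(1) G G] .
  show ?thesis
  proof (rule faithful_irrep.intro[OF V.vectorspace_axioms], rule faithful_irrep_axioms.intro)
    show "group G" by (rule G)
    show "\<rho> (\<alpha> (g \<otimes>\<^bsub>G\<^esub> h)) v = \<rho> (\<alpha> g) (\<rho> (\<alpha> h) v)"
      if "g \<in> carrier G" "h \<in> carrier G" "v \<in> carrier V" for g h v
      using that c by (simp add: hom_mult[OF \<alpha>(1)] mult)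
    show "g = \<one>\<^bsub>G\<^esub>" if g: "g \<in> carrier G" and "\<And>v. v \<in> carrier V \<Longrightarrow> \<rho> (\<alpha> g) v = v" for g
    proof -
      have "\<alpha> g = \<alpha> \<one>\<^bsub>G\<^esub>" using faithful[OF c[OF g]] that(2) one' by simp
      then show ?thesis using \<alpha>(2) g G by (meson group.is_monoid inj_onD monoid.one_closed)
    qed
    show "U = {\<zero>\<^bsub>V\<^esub>} \<or> U = carrier V"
      if U: "VectorSpace.subspace class_ring U V" and inv: "\<And>g u. g \<in> carrier G \<Longrightarrow> u \<in> U \<Longrightarrow> \<rho> (\<alpha> g) u \<in> U" for U
    proof (rule irreducible[OF U])
      fix g u assume gu: "g \<in> carrier G" "u \<in> U"
      then obtain h where "h \<in> carrier G" "g = \<alpha> h" using surj by blast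
      then show "\<rho> g u \<in> U" using inv gu by blast
    qed
  qed (use c one' one nontrivial in auto)
qed

text \<open>
  Take a nonzero average with \<open>T a = a\<^sup>k T\<close>, twist \<open>\<sigma>\<close> by an automorphism extending
  \<open>a \<mapsto> a\<^sup>k\<close> so that \<open>T\<close> commutes with \<open>A\<close>, and average over the cosets of \<open>A\<close>.
\<close>
lemma (in irrep_pair) equivalent_up_to_automorphism:
  assumes fd: "R.V.fin_dim"
  obtains \<alpha> S where "\<alpha> \<in> hom G G" "inj_on \<alpha> (carrier G)"
    "S \<in> LinearCombinations.module_hom class_ring V W" "bij_betw S (carrier V) (carrier W)"
    "\<And>x v. x \<in> carrier G \<Longrightarrow> v \<in> carrier V \<Longrightarrow> S (\<rho> x v) = \<sigma> (\<alpha> x) (S v)"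
proof -
  obtain k T v where k: "coprime (int k) n" and T: "T \<in> LinearCombinations.module_hom class_ring V W"
    and v: "v \<in> carrier V" "T v \<noteq> \<zero>\<^bsub>W\<^esub>"
    and eq: "\<And>v. v \<in> carrier V \<Longrightarrow> T (\<rho> a v) = \<sigma> (a [^] int k) (T v)"
    using twisted_A_hom_exists[OF fd] by metis
  obtain \<alpha> where \<alpha>: "\<alpha> \<in> hom G G" "inj_on \<alpha> (carrier G)" "\<alpha> a = a [^] int k"
    using power_automorphism[OF k] by blast
  interpret S': faithful_irrep W G "\<lambda>g. \<sigma> (\<alpha> g)"
    by (rule S.twist[OF finite_carrier \<alpha>(1,2)])
  interpret P: irrep_pair G a s V \<rho> W "\<lambda>g. \<sigma> (\<alpha> g)" ..
  obtain S u where S: "S \<in> LinearCombinations.module_hom class_ring V W" "u \<in> carrier V" "S u \<noteq> \<zero>\<^bsub>W\<^esub>"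
    and Seq: "\<And>x v. x \<in> carrier G \<Longrightarrow> v \<in> carrier V \<Longrightarrow> S (\<rho> x v) = \<sigma> (\<alpha> x) (S v)"
    using P.equivariant_hom_exists[OF T _ v] eq \<alpha>(3) by metis
  show thesis
    using that[OF \<alpha>(1,2) S(1) P.equivariant_hom_bij[OF S(1) Seq S(2,3)] Seq] .
qed

section \<open>Minimal subspaces and a function with vanishing coset sums\<close>

context vectorspace
begin

lemma subspace_subset: "VectorSpace.subspace K U V \<Longrightarrow> U \<subseteq> carrier V"
  using is_module submodule.subset by blast

lemma subspace_basis:
  assumes fd: "fin_dim" and U: "VectorSpace.subspace K U V"
  obtains B where "finite B" "B \<subseteq> U" "lin_indpt B" "span B = U"
proof -
  note UV = subspace_subset[OF U]
  let ?P = "\<lambda>B. B \<subseteq> U \<and> lin_indpt B"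
  have P0: "?P {}" by (auto simp: lin_dep_def)
  have bound: "\<forall>B. ?P B \<longrightarrow> card B < Suc dim"
    using li_le_dim(2)[OF fd] UV by (auto simp: less_Suc_eq_le)
  obtain B where B: "?P B" and max: "\<And>C. ?P C \<Longrightarrow> card C \<le> card B"
    using ex_has_greatest_nat[OF P0 bound] by blast
  have fin: "finite C" if "?P C" for C using li_le_dim(1)[OF fd, of C] that UV by blast
  have "span B = U"
  proof
    show "span B \<subseteq> U" using B is_module[OF U] span_is_subset by blast
    show "U \<subseteq> span B"
    proof
      fix u assume u: "u \<in> U"
      show "u \<in> span B"
      proof (rule ccontr)
        assume nspan: "u \<notin> span B"
        have BV: "B \<subseteq> carrier V" using B UV by blast
        have nB: "u \<notin> B" using span_mem[OF BV] nspan by blast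
        have "lin_indpt (B \<union> {u})" using lin_dep_iff_in_span[OF BV _ _ nB] B u UV nspan by blast
        then have "card (B \<union> {u}) \<le> card B" using max[of "B \<union> {u}"] B u by blast
        then show False using fin[OF B] nB by simp
      qed
    qed
  qed
  then show thesis using that[OF fin[OF B]] B by blast
qed

lemma card_lin_indpt_le_span:
  assumes "finite B" "B \<subseteq> carrier V" "finite C" "lin_indpt C" "C \<subseteq> span B"
  shows "card C \<le> card B"
  using replacement[OF assms(3,1,2,4,5)] by auto

text \<open>
  Minimise the size of a basis; a proper subspace has a smaller one.
\<close>
lemma minimal_subspace_exists:
  assumes fd: "fin_dim" and P: "P U\<^sub>0" and sub: "\<And>U. P U \<Longrightarrow> VectorSpace.subspace K U V"
  obtains U where "P U" "\<And>U'. P U' \<Longrightarrow> U' \<subseteq> U \<Longrightarrow> U' = U"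
proof -
  let ?basis = "\<lambda>U B. finite B \<and> B \<subseteq> U \<and> lin_indpt B \<and> span B = U"
  let ?d = "\<lambda>U. LEAST d. \<exists>B. ?basis U B \<and> card B = d"
  have d: "\<exists>B. ?basis U B \<and> card B = ?d U" if "P U" for U
  proof (rule LeastI_ex)
    show "\<exists>d B. ?basis U B \<and> card B = d" using subspace_basis[OF fd sub[OF that]] by metis
  qed
  obtain U where U: "P U" and min: "\<And>U'. P U' \<Longrightarrow> ?d U \<le> ?d U'"
    using arg_min_nat_lemma[of P U\<^sub>0 ?d] P by blast
  obtain B where B: "?basis U B" "card B = ?d U" using d[OF U] by blast
  have BV: "B \<subseteq> carrier V" using B subspace_subset[OF sub[OF U]] by blast
  have "U' = U" if U': "P U'" "U' \<subseteq> U" for U'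
  proof (rule ccontr)
    assume "U' \<noteq> U"
    then obtain u where u: "u \<in> U" "u \<notin> U'" using U' by blast
    obtain B' where B': "?basis U' B'" "card B' = ?d U'" using d[OF U'(1)] by blast
    have B'V: "B' \<subseteq> carrier V" using B' subspace_subset[OF sub[OF U'(1)]] by blast
    have uV: "u \<in> carrier V" using u subspace_subset[OF sub[OF U]] by blast
    have nB: "u \<notin> B'" using u B' by blast
    have "lin_indpt (B' \<union> {u})" using lin_dep_iff_in_span[OF B'V _ uV nB] B' u by blast
    then have "card (B' \<union> {u}) \<le> card B"
      using card_lin_indpt_le_span[of B "B' \<union> {u}"] B BV B' u U' by auto
    then show False using nB B' B min[OF U'(1)] by simp
  qed
  then show thesis using that[OF U] by blast
qed

lemma subspace_fin_dim:
  assumes fd: "fin_dim" and U: "VectorSpace.subspace K U V"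
  shows "vectorspace.fin_dim K (vs U)"
proof -
  obtain B where B: "finite B" "B \<subseteq> U" "span B = U" using subspace_basis[OF fd U] by metis
  have "LinearCombinations.module.span K (vs U) B = U"
    using span_li_not_depend(1)[OF B(2) is_module[OF U]] B(3) by simp
  then show ?thesis unfolding vectorspace.fin_dim_def[OF subspace_is_vs[OF U]] using B by auto
qed

end

text \<open>
  Let \<open>p\<^sup>e\<close> be the exact power of the prime \<open>p\<close> in \<open>n\<close>. The function
  \<open>[p\<^sup>e dvd i] - [p\<^sup>e dvd i - n/p]\<close> sums to zero over the \<open>p\<close> translates of \<open>i\<close> by multiples of
  \<open>n/p\<close>, the sum being telescopic. Multiply these functions over the primes of \<open>n\<close>: translation by
  \<open>n/p\<close> changes only the factor of \<open>p\<close>. The product lists the coefficients of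
  \<open>\<Prod>(1 - a\<^bsup>n/p\<^esup>)\<close> in the group algebra of a cyclic group, and its value 1 at 0 shows that
  this element is nonzero.
\<close>
lemma coset_sum_zero_function:
  fixes n :: nat
  assumes n: "n > 0"
  obtains c :: "int \<Rightarrow> 'k :: comm_ring_1" where "c 0 = 1" "\<And>i j. [i = j] (mod int n) \<Longrightarrow> c i = c j"
    "\<And>p i. prime p \<Longrightarrow> p dvd n \<Longrightarrow> (\<Sum>t<p. c (i + int (n div p) * int t)) = 0"
proof -
  define B :: "nat \<Rightarrow> int \<Rightarrow> 'k" where "B p i = of_bool (int p ^ multiplicity p n dvd i)" for p i
  define c where "c i = (\<Prod>p\<in>prime_factors n. B p i - B p (i - int (n div p)))" for i
  have pn: "int p ^ multiplicity p n dvd int n" for p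
    using multiplicity_dvd[of p n] by (simp flip: of_nat_power)
  have B_cong: "B p i = B p j" if "[i = j] (mod int n)" for p i j
    using cong_dvd_iff[OF cong_dvd_modulus[OF that pn]] by (simp add: B_def)
  show thesis
  proof (rule that)
    show "c 0 = 1"
      unfolding c_def
    proof (rule prod.neutral, intro ballI)
      fix p assume p: "p \<in> prime_factors n"
      then have pp: "prime p" "p dvd n" by auto
      have "\<not> p ^ multiplicity p n dvd n div p"
      proof
        assume "p ^ multiplicity p n dvd n div p"
        then have "p ^ Suc (multiplicity p n) dvd n"
          using pp(2) by (metis dvd_div_mult_self mult_dvd_mono dvd_refl power_Suc2)
        then show False using n pp(1) power_dvd_iff_le_multiplicity[of n p "Suc (multiplicity p n)"]
            prime_gt_1_nat[OF pp(1)]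
          by auto
      qed
      then have "\<not> int p ^ multiplicity p n dvd int (n div p)"
        by (simp flip: of_nat_power)
      then show "B p 0 - B p (0 - int (n div p)) = 1" by (simp add: B_def)
    qed
    show "c i = c j" if ij: "[i = j] (mod int n)" for i j
      unfolding c_def using B_cong[OF ij] B_cong[OF cong_diff[OF ij cong_refl]] by simp
    fix p i assume p: "prime p" "p dvd n"
    let ?m = "int (n div p)"
    have pm: "int p * ?m = int n" using p(2) by (metis dvd_mult_div_cancel of_nat_mult)
    have pf: "p \<in> prime_factors n" using p n by (simp add: prime_factors_dvd)
    have other: "B q (j + ?m * int t) = B q j" if "q \<in> prime_factors n" "q \<noteq> p" for q j t
    proof -
      have "coprime (q ^ multiplicity q n) p"
        using that p(1) by (auto intro: primes_coprime)
      moreover have "q ^ multiplicity q n dvd p * (n div p)" using multiplicity_dvd[of q n] p(2) by simp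
      ultimately have "q ^ multiplicity q n dvd n div p" by (simp add: coprime_dvd_mult_right_iff)
      then have "int q ^ multiplicity q n dvd ?m" by (simp flip: of_nat_power)
      then show ?thesis by (simp add: B_def dvd_add_left_iff)
    qed
    let ?K = "\<Prod>q\<in>prime_factors n - {p}. B q i - B q (i - int (n div q))"
    let ?F = "\<lambda>t. B p (i - ?m + ?m * int t)"
    have "c (i + ?m * int t) = (?F (Suc t) - ?F t) * ?K" for t
    proof -
      have "(\<Prod>q\<in>prime_factors n - {p}. B q (i + ?m * int t) - B q (i + ?m * int t - int (n div q))) = ?K"
      proof (rule prod.cong[OF refl])
        fix q assume q: "q \<in> prime_factors n - {p}"
        then have q': "q \<in> prime_factors n" "q \<noteq> p" by auto
        have e: "i + ?m * int t - int (n div q) = (i - int (n div q)) + ?m * int t" by simp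
        show "B q (i + ?m * int t) - B q (i + ?m * int t - int (n div q)) = B q i - B q (i - int (n div q))"
          unfolding e other[OF q'] ..
      qed
      then show ?thesis
        unfolding c_def by (subst prod.remove[OF _ pf]) (simp_all add: algebra_simps)
    qed
    then have "(\<Sum>t<p. c (i + ?m * int t)) = (\<Sum>t<p. ?F (Suc t) - ?F t) * ?K"
      by (simp add: sum_distrib_right)
    also have "(\<Sum>t<p. ?F (Suc t) - ?F t) = ?F p - ?F 0" by (rule sum_lessThan_telescope)
    also have "?F p = ?F 0"
      by (rule B_cong) (use pm in \<open>simp add: cong_iff_dvd_diff mult.commute\<close>)
    finally show "(\<Sum>t<p. c (i + ?m * int t)) = 0" by simp
  qed
qed

section \<open>Existence of a faithful irreducible representation\<close>

text \<open>
  \<open>G\<close> acts on the functions \<open>G \<rightarrow> K\<close> by right translation; a function is encoded as a vector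
  of length \<open>|G|\<close> through an enumeration \<open>h\<close> of \<open>G\<close>, with \<open>ev v x\<close> its value at \<open>x\<close>.
  Let \<open>M\<close> be the space of functions with sum zero on every coset of every subgroup
  \<open>\<langle>z p\<rangle>\<close> of prime order \<open>p\<close> in \<open>A\<close>. These subgroups are central, so \<open>M\<close> is invariant. A
  function fixed by \<open>z p\<close> is constant on the cosets, so in characteristic zero \<open>z p\<close> fixes
  only 0 in \<open>M\<close>. A minimal nonzero invariant subspace \<open>U\<close> of \<open>M\<close> is irreducible, and nontrivial elements of
  \<open>A\<close> act nontrivially on it. If \<open>g\<close> acts trivially, so does its commutator with \<open>a\<close>,
  which lies in \<open>A\<close>; hence \<open>g\<close> centralizes \<open>a\<close>, lies in \<open>A\<close> and is 1.
\<close>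
lemma (in ANC_cyclic) faithful_irrep_exists:
  obtains V :: "('k :: field_char_0, 'k vec) module" and \<rho>
  where "faithful_irrep V G \<rho>" "vectorspace.fin_dim class_ring V"
proof -
  define m where "m = card (carrier G)"
  obtain h where h: "bij_betw h {0..<m} (carrier G)"
    using ex_bij_betw_nat_finite[OF finite_carrier] m_def by blast
  define ix where "ix = inv_into {0..<m} h"
  have ix: "ix x < m" "h (ix x) = x" if "x \<in> carrier G" for x
    using that h bij_betw_inv_into_right[OF h that] bij_betwE[OF bij_betw_inv_into[OF h]]
    by (auto simp: ix_def)
  have hG: "h i \<in> carrier G" and ixh: "ix (h i) = i" if "i < m" for i
    using that bij_betwE[OF h] bij_betw_inv_into_left[OF h] by (auto simp: ix_def)
  let ?V = "module_vec TYPE('k) m"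
  interpret V: vectorspace "class_ring :: 'k ring" ?V by (rule vec_vs)
  have V_simps: "carrier ?V = carrier_vec m" "add ?V = (+)" "zero ?V = 0\<^sub>v m" "module.smult ?V = (\<cdot>\<^sub>v)"
    by (simp_all add: module_vec_simps)
  define ev :: "'k vec \<Rightarrow> 'a \<Rightarrow> 'k" where "ev v x = v $ ix x" for v x
  define \<rho> :: "'a \<Rightarrow> 'k vec \<Rightarrow> 'k vec" where "\<rho> g v = vec m (\<lambda>i. ev v (h i \<otimes> g))" for g v
  have \<rho>_closed: "\<rho> g v \<in> carrier_vec m" for g v by (simp add: \<rho>_def)
  have ev_\<rho>: "ev (\<rho> g v) x = ev v (x \<otimes> g)" if "x \<in> carrier G" for g v x
    using ix[OF that] by (simp add: ev_def \<rho>_def)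
  have ev_eqI: "u = v" if uv: "u \<in> carrier_vec m" "v \<in> carrier_vec m"
    and ev: "\<And>x. x \<in> carrier G \<Longrightarrow> ev u x = ev v x" for u v
  proof (rule eq_vecI)
    show "u $ i = v $ i" if "i < dim_vec v" for i
      using ev[of "h i"] hG[of i] ixh[of i] that uv by (simp add: ev_def)
  qed (use uv in simp)
  have ev_add: "ev (u + v) x = ev u x + ev v x" if "u \<in> carrier_vec m" "v \<in> carrier_vec m" "x \<in> carrier G" for u v x
    using that ix by (simp add: ev_def)
  have ev_smult: "ev (c \<cdot>\<^sub>v v) x = c * ev v x" if "v \<in> carrier_vec m" "x \<in> carrier G" for c v x
    using that ix by (simp add: ev_def)
  have ev_zero: "ev (0\<^sub>v m) x = 0" if "x \<in> carrier G" for x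
    using that ix by (simp add: ev_def)
  have \<rho>_add: "\<rho> g (u + v) = \<rho> g u + \<rho> g v"
    if "g \<in> carrier G" "u \<in> carrier_vec m" "v \<in> carrier_vec m" for g u v
    by (rule ev_eqI) (use that in \<open>simp_all add: \<rho>_closed ev_\<rho> ev_add\<close>)
  have \<rho>_smult: "\<rho> g (c \<cdot>\<^sub>v v) = c \<cdot>\<^sub>v \<rho> g v" if "g \<in> carrier G" "v \<in> carrier_vec m" for c g v
    by (rule ev_eqI) (use that in \<open>simp_all add: \<rho>_closed ev_\<rho> ev_smult\<close>)
  have \<rho>_mult: "\<rho> (g \<otimes> g') v = \<rho> g (\<rho> g' v)" if "g \<in> carrier G" "g' \<in> carrier G" for g g' v
    by (rule ev_eqI) (use that in \<open>simp_all add: \<rho>_closed ev_\<rho> m_assoc\<close>)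
  have \<rho>_one: "\<rho> \<one> v = v" if "v \<in> carrier_vec m" for v
    by (rule ev_eqI) (use that in \<open>simp_all add: \<rho>_closed ev_\<rho>\<close>)

  define z where "z p = a [^] (ord a div p)" for p :: nat
  have z_int: "z p [^] (t :: nat) = a [^] (int (ord a div p) * int t)" for p t
    by (simp add: z_def nat_pow_pow int_pow_int flip: of_nat_mult)
  have z_central: "g \<otimes> z p [^] (t :: nat) = z p [^] t \<otimes> g"
    if "prime p" "p dvd ord a" "g \<in> carrier G" for p t g
    using prime_order_elt_central[of "int p" g "int t"] that by (simp add: z_int zdiv_int)
  define M where "M = {v \<in> carrier_vec m. \<forall>p. prime p \<and> p dvd ord a \<longrightarrow>
    (\<forall>x\<in>carrier G. (\<Sum>t<p. ev v (x \<otimes> z p [^] t)) = 0)}"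
  have zc: "z p [^] (t :: nat) \<in> carrier G" for p t by (simp add: z_def)
  have M_sub: "VectorSpace.subspace class_ring M ?V"
    unfolding VectorSpace.subspace_def LinearCombinations.submodule_def
  proof (intro conjI allI impI)
    show "vectorspace class_ring ?V" "Module.module class_ring ?V" by unfold_locales
    show "M \<subseteq> carrier ?V" by (auto simp: M_def V_simps)
    show "\<zero>\<^bsub>?V\<^esub> \<in> M" using zc by (simp add: M_def V_simps ev_zero)
    show "u \<oplus>\<^bsub>?V\<^esub> v \<in> M" if "u \<in> M" "v \<in> M" for u v
      using that zc by (simp add: M_def V_simps ev_add sum.distrib)
    show "c \<odot>\<^bsub>?V\<^esub> v \<in> M" if "v \<in> M" for c v
      using that zc by (simp add: M_def V_simps ev_smult flip: sum_distrib_left)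
  qed
  have M_inv: "\<rho> g v \<in> M" if g: "g \<in> carrier G" and v: "v \<in> M" for g v
    unfolding M_def
  proof (intro CollectI conjI allI impI ballI \<rho>_closed; elim conjE)
    fix p x assume p: "prime p" "p dvd ord a" and x: "x \<in> carrier G"
    have "ev (\<rho> g v) (x \<otimes> z p [^] t) = ev v ((x \<otimes> g) \<otimes> z p [^] t)" for t :: nat
      using z_central[OF p g, of t] x g zc by (simp add: ev_\<rho> m_assoc)
    then show "(\<Sum>t<p. ev (\<rho> g v) (x \<otimes> z p [^] t)) = 0"
      using v p x g by (simp add: M_def)
  qed
  have M_fixed: "v = 0\<^sub>v m" if v: "v \<in> M" and p: "prime p" "p dvd ord a" and fixed: "\<rho> (z p) v = v" for v p
  proof (rule ev_eqI)
    show "v \<in> carrier_vec m" "0\<^sub>v m \<in> carrier_vec m" using v by (auto simp: M_def)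
    fix x assume x: "x \<in> carrier G"
    have zpc: "z p \<in> carrier G" using zc[of p 1] by (simp add: z_def)
    have ev_orbit: "ev v (x \<otimes> z p [^] t) = ev v x" for t :: nat
    proof (induction t)
      case (Suc t)
      have "ev v (x \<otimes> z p [^] Suc t) = ev (\<rho> (z p) v) (x \<otimes> z p [^] t)"
        using ev_\<rho>[of "x \<otimes> z p [^] t" "z p" v] x zc zpc by (simp add: m_assoc)
      then show ?case using Suc fixed by simp
    qed (use x in simp)
    have "(\<Sum>t<p. ev v (x \<otimes> z p [^] t)) = 0" using v p x by (simp add: M_def)
    then have "of_nat p * ev v x = 0" by (simp add: ev_orbit)
    then have "ev v x = 0" using prime_gt_0_nat[OF p(1)] by simp
    then show "ev v x = ev (0\<^sub>v m) x" using ev_zero[OF x] by simp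
  qed
  have M_nz: "\<exists>v\<in>M. v \<noteq> 0\<^sub>v m"
  proof -
    have "ord a > 0" using n_pos by simp
    then obtain c :: "int \<Rightarrow> 'k" where c: "c 0 = 1" "\<And>i j. [i = j] (mod n) \<Longrightarrow> c i = c j"
      "\<And>p i. prime p \<Longrightarrow> p dvd ord a \<Longrightarrow> (\<Sum>t<p. c (i + int (ord a div p) * int t)) = 0"
      using coset_sum_zero_function by metis
    define lg where "lg x = (SOME i :: int. x = a [^] i)" for x
    have "a [^] i = a [^] lg (a [^] i)" for i :: int
      unfolding lg_def by (rule someI) simp
    then have lg: "c (lg (a [^] i)) = c i" for i :: int
      by (intro c(2)) (metis a_pow_eq_iff)
    let ?f = "\<lambda>x. if x \<in> A then c (lg x) else 0"
    define v where "v = vec m (\<lambda>i. ?f (h i))"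
    have ev_v: "ev v x = ?f x" if "x \<in> carrier G" for x
      using ix[OF that] by (simp add: ev_def v_def)
    have "v \<in> M"
      unfolding M_def
    proof (intro CollectI conjI allI impI ballI; (elim conjE)?)
      show "v \<in> carrier_vec m" by (simp add: v_def)
      fix p x assume p: "prime p" "p dvd ord a" and x: "x \<in> carrier G"
      show "(\<Sum>t<p. ev v (x \<otimes> z p [^] t)) = 0"
      proof (cases "x \<in> A")
        case True
        then obtain i where i: "x = a [^] (i :: int)" by (auto simp: A_def)
        have "ev v (x \<otimes> z p [^] t) = c (i + int (ord a div p) * int t)" for t :: nat
          using ev_v[of "x \<otimes> z p [^] t"] lg by (simp add: i z_int flip: int_pow_mult)
        then show ?thesis using c(3)[OF p] by simp
      next
        case False
        have "x \<otimes> z p [^] t \<notin> A" for t :: nat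
          using z_central[OF p x, of t] A_mult_left_cancel[of "z p [^] t" x] x False by (simp add: z_int)
        then show ?thesis using x zc by (simp add: ev_v)
      qed
    qed
    moreover have "ev v \<one> = 1"
      using ev_v[of \<one>] lg[of 0] c(1) subgroup.one_closed[OF A_subgroup] by simp
    then have "v \<noteq> 0\<^sub>v m" using ev_zero[of \<one>] by auto
    ultimately show ?thesis by blast
  qed
  let ?P = "\<lambda>U. VectorSpace.subspace class_ring U ?V \<and> U \<subseteq> M \<and> U \<noteq> {0\<^sub>v m} \<and> (\<forall>g\<in>carrier G. \<forall>u\<in>U. \<rho> g u \<in> U)"
  have PM: "?P M" using M_sub M_inv M_nz by blast
  obtain U where U: "?P U" and min: "\<And>U'. ?P U' \<Longrightarrow> U' \<subseteq> U \<Longrightarrow> U' = U"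
    using V.minimal_subspace_exists[of ?P M, OF vec_space.fin_dim PM] by blast
  have U_sub: "VectorSpace.subspace class_ring U ?V" and UM: "U \<subseteq> M" using U by auto
  have U_carrier: "u \<in> carrier_vec m" if "u \<in> U" for u using that UM by (auto simp: M_def)
  have U_zero: "0\<^sub>v m \<in> U" using U_sub by (auto simp: VectorSpace.subspace_def submodule_def V_simps)
  have fixed_zero: "u = 0\<^sub>v m"
    if x: "x \<in> A" "x \<noteq> \<one>" and triv: "\<And>u. u \<in> U \<Longrightarrow> \<rho> x u = u" and u: "u \<in> U" for x u
  proof -
    obtain i where i: "x = a [^] (i :: int)" using x by (auto simp: A_def)
    have "\<rho> (x [^] (j :: nat)) u = u" for j
    proof (induction j)
      case (Suc j)
      then show ?case using triv[OF u] \<rho>_mult[of "x [^] j" x u] A_closed[OF x(1)] by simp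
    qed (use \<rho>_one U_carrier[OF u] in simp)
    \<comment> \<open>\<open>\<langle>x\<rangle>\<close> is generated by \<open>a\<^bsup>d\<^esup>\<close> for \<open>d = gcd i n\<close>, and \<open>n/p\<close> is a multiple of \<open>d\<close> for a prime \<open>p\<close> of \<open>n/d\<close>\<close>
    moreover obtain p j where "prime p" "p dvd ord a" "x [^] (j :: nat) = z p"
    proof -
      have xc: "x \<in> carrier G" using A_closed x by blast
      define d where "d = gcd i n"
      have "d dvd n" "d > 0" using n_pos by (auto simp: d_def)
      have "\<not> n dvd i" using x(2) i by (simp add: a_pow_eq_one_iff)
      then have "d \<noteq> n" by (metis d_def gcd_dvd1)
      obtain q where q: "n = d * q" using \<open>d dvd n\<close> by (auto elim: dvdE)
      have "q > 0" using q n_pos \<open>d > 0\<close> by (metis zero_less_mult_pos)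
      moreover have "q \<noteq> 1" using q \<open>d \<noteq> n\<close> by auto
      ultimately have "nat q \<noteq> 1" by auto
      then obtain p where p: "prime p" "p dvd nat q" using prime_factor_nat by blast
      then have "int p dvd q" using \<open>q > 0\<close> by (simp add: int_dvd_int_iff nat_dvd_iff flip: int_dvd_int_iff)
      then obtain l where l: "q = int p * l" by (auto elim: dvdE)
      have pn: "p dvd ord a" using q l by (metis dvd_triv_left dvd_mult int_dvd_int_iff)
      have np: "int (ord a div p) = d * l"
        using q l prime_gt_0_nat[OF p(1)] by (simp add: zdiv_int mult.left_commute)
      obtain u v where uv: "u * i + v * n = d" using bezout_int[of i n] d_def by auto
      have "a [^] int (ord a div p) = a [^] (i * (u * l))"
        unfolding a_pow_eq_iff np by (simp add: cong_iff_dvd_diff algebra_simps flip: uv)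
      then have zx: "z p = x [^] (u * l)" by (simp add: z_def i int_pow_pow int_pow_int)
      have "x [^] (u * l) = x [^] nat ((u * l) mod n)"
      proof -
        have "[i * (u * l) = i * ((u * l) mod n)] (mod n)" by (simp add: cong_def mod_mult_right_eq)
        then have "x [^] (u * l) = x [^] ((u * l) mod n)" by (simp add: i int_pow_pow a_pow_eq_iff)
        moreover have "(u * l) mod n = int (nat ((u * l) mod n))" using n_pos by simp
        ultimately show ?thesis by (metis int_pow_int)
      qed
      then show thesis using that[OF p(1) pn] zx by simp
    qed
    ultimately show ?thesis using M_fixed[of u p] u UM by (metis subsetD)
  qed
  let ?W = "?V\<lparr>carrier := U\<rparr>"
  have W_vs: "vectorspace class_ring ?W" by (rule V.subspace_is_vs[OF U_sub])
  have W_sub: "VectorSpace.subspace class_ring U' ?V" if "VectorSpace.subspace class_ring U' ?W" for U'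
  proof -
    have "U' \<subseteq> U" "U \<subseteq> carrier ?V" using that U_sub
      by (auto simp: VectorSpace.subspace_def LinearCombinations.submodule_def)
    then show ?thesis using that V.vectorspace_axioms V.module_axioms
      by (auto simp: VectorSpace.subspace_def LinearCombinations.submodule_def)
  qed
  have "faithful_irrep ?W G \<rho>"
  proof (rule faithful_irrep.intro[OF W_vs], rule faithful_irrep_axioms.intro)
    show "group G" by (rule is_group)
    show "\<rho> g v \<in> carrier ?W" if "g \<in> carrier G" "v \<in> carrier ?W" for g v using that U by simp
    show "\<rho> g (u \<oplus>\<^bsub>?W\<^esub> v) = \<rho> g u \<oplus>\<^bsub>?W\<^esub> \<rho> g v" if "g \<in> carrier G" "u \<in> carrier ?W" "v \<in> carrier ?W" for g u v
      using that \<rho>_add U_carrier by (simp add: V_simps)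
    show "\<rho> g (c \<odot>\<^bsub>?W\<^esub> v) = c \<odot>\<^bsub>?W\<^esub> \<rho> g v" if "g \<in> carrier G" "v \<in> carrier ?W" for g c v
      using that \<rho>_smult U_carrier by (simp add: V_simps)
    show "\<rho> (g \<otimes> g') v = \<rho> g (\<rho> g' v)" if "g \<in> carrier G" "g' \<in> carrier G" "v \<in> carrier ?W" for g g' v
      using that \<rho>_mult by simp
    show "\<rho> \<one> v = v" if "v \<in> carrier ?W" for v using that \<rho>_one U_carrier by simp
    show nontriv: "carrier ?W \<noteq> {\<zero>\<^bsub>?W\<^esub>}" using U by (simp add: V_simps)
    obtain u0 where u0: "u0 \<in> U" "u0 \<noteq> 0\<^sub>v m" using U U_zero by blast
    show "g = \<one>" if g: "g \<in> carrier G" and triv: "\<And>v. v \<in> carrier ?W \<Longrightarrow> \<rho> g v = v" for g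
    proof -
      let ?c = "g \<otimes> a \<otimes> inv g \<otimes> inv a"
      have inv_triv: "\<rho> (inv g) u = u" if "u \<in> U" for u
        using \<rho>_mult[of "inv g" g u] g \<rho>_one[OF U_carrier[OF that]] triv[of u] that by simp
      have "\<rho> ?c u = u" if u: "u \<in> U" for u
      proof -
        have au: "\<rho> (inv a) u \<in> U" using U u by simp
        have "\<rho> ?c u = \<rho> g (\<rho> a (\<rho> (inv g) (\<rho> (inv a) u)))" using g by (simp add: \<rho>_mult)
        also have "\<dots> = \<rho> g (\<rho> a (\<rho> (inv a) u))" using inv_triv[OF au] by simp
        also have "\<rho> a (\<rho> (inv a) u) = u" using \<rho>_mult[of a "inv a" u] \<rho>_one[OF U_carrier[OF u]] by simp
        finally show ?thesis using triv[of u] u by simp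
      qed
      then have "?c = \<one>" using fixed_zero[OF commutator_in_A[OF g a_closed] _ _ u0(1)] u0(2) by blast
      then have "g \<otimes> a \<otimes> inv g = a"
        using inv_equality[of "g \<otimes> a \<otimes> inv g" "inv a"] g by simp
      then have "a [^] s g = a [^] (1 :: int)" using conj_a[OF g] by simp
      then have "g \<in> A" unfolding mem_A_iff[OF g] a_pow_eq_iff cong_iff_dvd_diff .
      then show "g = \<one>" using fixed_zero[OF _ _ _ u0(1)] triv u0(2) by fastforce
    qed
    show "U' = {\<zero>\<^bsub>?W\<^esub>} \<or> U' = carrier ?W"
      if U': "VectorSpace.subspace class_ring U' ?W" and inv: "\<And>g u. g \<in> carrier G \<Longrightarrow> u \<in> U' \<Longrightarrow> \<rho> g u \<in> U'" for U'
    proof (cases "U' = {0\<^sub>v m}")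
      case False
      have "U' \<subseteq> U" using U' by (auto simp: VectorSpace.subspace_def LinearCombinations.submodule_def)
      then show ?thesis using min[of U'] W_sub[OF U'] False inv UM by auto
    qed (simp add: V_simps)
  qed
  then show thesis using that V.subspace_fin_dim[OF vec_space.fin_dim U_sub] by blast
qed

section \<open>Linear groups and representations\<close>

lemma GL_simps:
  "carrier (GL K V) = LinearCombinations.module_hom K V V \<inter> Bij (carrier V)"
  "\<one>\<^bsub>GL K V\<^esub> = (\<lambda>v\<in>carrier V. v)"
  by (simp_all add: GL_def BijGroup_def)

lemma GL_mult:
  "f \<in> carrier (GL K V) \<Longrightarrow> g \<in> carrier (GL K V) \<Longrightarrow> f \<otimes>\<^bsub>GL K V\<^esub> g = compose (carrier V) f g"
  by (simp add: GL_def BijGroup_def)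

lemma group_GL:
  assumes "vectorspace K V"
  shows "group (GL K V)"
proof -
  interpret vectorspace K V by fact
  interpret B: group "BijGroup (carrier V)" by (rule group_BijGroup)
  have "subgroup (LinearCombinations.module_hom K V V \<inter> Bij (carrier V)) (BijGroup (carrier V))"
  proof (rule B.subgroupI)
    show "LinearCombinations.module_hom K V V \<inter> Bij (carrier V) \<subseteq> carrier (BijGroup (carrier V))"
      by (simp add: BijGroup_def)
    have "(\<lambda>v\<in>carrier V. v) \<in> LinearCombinations.module_hom K V V \<inter> Bij (carrier V)"
      by (auto simp: LinearCombinations.module_hom_def id_Bij)
    then show "LinearCombinations.module_hom K V V \<inter> Bij (carrier V) \<noteq> {}" by blast
  next
    fix f assume f: "f \<in> LinearCombinations.module_hom K V V \<inter> Bij (carrier V)"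
    let ?i = "\<lambda>v\<in>carrier V. inv_into (carrier V) f v"
    have i: "?i \<in> Bij (carrier V)" using f restrict_inv_into_Bij by blast
    have ic: "inv_into (carrier V) f v \<in> carrier V" if "v \<in> carrier V" for v
      using f Bij_inv_into_mem[OF _ that] by simp
    have fi: "f (inv_into (carrier V) f v) = v" if "v \<in> carrier V" for v
      using f that by (auto simp: Bij_def intro: bij_betw_inv_into_right)
    have hom: "f \<in> LinearCombinations.module_hom K V V" using f by blast
    have inj: "inj_on f (carrier V)" using f by (auto simp: Bij_def bij_betw_def)
    have "?i \<in> LinearCombinations.module_hom K V V"
      unfolding LinearCombinations.module_hom_def
    proof (intro CollectI conjI allI impI; (elim conjE)?)
      show "?i \<in> carrier V \<rightarrow> carrier V" using ic by auto
      fix u v assume uv: "u \<in> carrier V" "v \<in> carrier V"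
      have "f (inv_into (carrier V) f u \<oplus>\<^bsub>V\<^esub> inv_into (carrier V) f v) = u \<oplus>\<^bsub>V\<^esub> v"
        using LinearCombinations.module_hom_add[OF hom ic[OF uv(1)] ic[OF uv(2)]] uv fi by simp
      then have "inv_into (carrier V) f (u \<oplus>\<^bsub>V\<^esub> v) = inv_into (carrier V) f u \<oplus>\<^bsub>V\<^esub> inv_into (carrier V) f v"
        using uv ic by (intro inv_into_f_eq[OF inj]) auto
      then show "?i (u \<oplus>\<^bsub>V\<^esub> v) = ?i u \<oplus>\<^bsub>V\<^esub> ?i v" using uv by simp
    next
      fix c v assume cv: "c \<in> carrier K" "v \<in> carrier V"
      have "f (c \<odot>\<^bsub>V\<^esub> inv_into (carrier V) f v) = c \<odot>\<^bsub>V\<^esub> v"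
        using LinearCombinations.module_hom_smult[OF hom cv(1) ic[OF cv(2)]] cv fi by simp
      then have "inv_into (carrier V) f (c \<odot>\<^bsub>V\<^esub> v) = c \<odot>\<^bsub>V\<^esub> inv_into (carrier V) f v"
        using cv ic by (intro inv_into_f_eq[OF inj]) auto
      then show "?i (c \<odot>\<^bsub>V\<^esub> v) = c \<odot>\<^bsub>V\<^esub> ?i v" using cv by simp
    qed
    then show "inv\<^bsub>BijGroup (carrier V)\<^esub> f \<in> LinearCombinations.module_hom K V V \<inter> Bij (carrier V)"
      using f i by (simp add: inv_BijGroup)
  next
    fix f g assume fg: "f \<in> LinearCombinations.module_hom K V V \<inter> Bij (carrier V)"
      "g \<in> LinearCombinations.module_hom K V V \<inter> Bij (carrier V)"
    have "f v \<in> carrier V" "g v \<in> carrier V" if "v \<in> carrier V" for v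
      using fg that Bij_imp_funcset by auto
    then have "compose (carrier V) f g \<in> LinearCombinations.module_hom K V V"
      using fg by (auto simp: LinearCombinations.module_hom_def compose_def)
    then show "f \<otimes>\<^bsub>BijGroup (carrier V)\<^esub> g \<in> LinearCombinations.module_hom K V V \<inter> Bij (carrier V)"
      using fg by (simp add: BijGroup_def compose_Bij)
  qed
  then show ?thesis unfolding GL_def by (rule subgroup.subgroup_is_group[OF _ group_BijGroup])
qed

lemma (in faithful_irrep) linear_group_of_irrep:
  assumes fd: "V.fin_dim"
  defines "H \<equiv> (\<lambda>g. restrict (\<rho> g) (carrier V)) ` carrier G"
  shows "irreducible_linear_group class_ring V H" and "G \<cong> (GL class_ring V)\<lparr>carrier := H\<rparr>"
proof -
  interpret G: group G by (rule G)
  interpret L: group "GL class_ring V" by (rule group_GL[OF V.vectorspace_axioms])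
  let ?\<phi> = "\<lambda>g. restrict (\<rho> g) (carrier V)"
  have bij: "bij_betw (\<rho> g) (carrier V) (carrier V)" if "g \<in> carrier G" for g
    by (rule bij_betw_byWitness[where f' = "\<rho> (inv\<^bsub>G\<^esub> g)"]) (use that in \<open>auto simp: rho_inv_cancel\<close>)
  have \<phi>_GL: "?\<phi> g \<in> carrier (GL class_ring V)" if "g \<in> carrier G" for g
  proof -
    have "?\<phi> g \<in> LinearCombinations.module_hom class_ring V V"
      by (rule module_homI) (use that in \<open>simp_all add: V.smult_closed\<close>)
    moreover have "?\<phi> g \<in> Bij (carrier V)" using bij[OF that] by (simp add: Bij_def cong: bij_betw_cong)
    ultimately show ?thesis by (simp add: GL_simps)
  qed
  have \<phi>_mult: "?\<phi> (g \<otimes>\<^bsub>G\<^esub> h) = ?\<phi> g \<otimes>\<^bsub>GL class_ring V\<^esub> ?\<phi> h" if "g \<in> carrier G" "h \<in> carrier G" for g h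
    unfolding GL_mult[OF \<phi>_GL[OF that(1)] \<phi>_GL[OF that(2)]]
    by (rule ext) (use that in \<open>simp add: compose_def restrict_def mult\<close>)
  have hom: "?\<phi> \<in> hom G (GL class_ring V)" using \<phi>_GL \<phi>_mult by (intro homI) auto
  have H: "subgroup H (GL class_ring V)"
    using group_hom.img_is_subgroup[of G "GL class_ring V" ?\<phi>] hom G.is_group L.is_group
    by (simp add: group_hom_def group_hom_axioms_def H_def)
  have "inj_on ?\<phi> (carrier G)"
  proof (rule inj_onI)
    fix g h assume gh: "g \<in> carrier G" "h \<in> carrier G" and eq: "?\<phi> g = ?\<phi> h"
    have "\<rho> (inv\<^bsub>G\<^esub> h \<otimes>\<^bsub>G\<^esub> g) v = v" if "v \<in> carrier V" for v
      using gh that fun_cong[OF eq, of v] by (simp add: mult rho_inv_cancel)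
    then have "inv\<^bsub>G\<^esub> h \<otimes>\<^bsub>G\<^esub> g = \<one>\<^bsub>G\<^esub>" using faithful gh by simp
    then show "g = h" using gh by (metis G.inv_closed G.inv_cancel(2) G.r_one)
  qed
  then have "?\<phi> \<in> iso G ((GL class_ring V)\<lparr>carrier := H\<rparr>)"
    using hom by (auto simp: iso_def hom_def H_def bij_betw_def)
  then show "G \<cong> (GL class_ring V)\<lparr>carrier := H\<rparr>" by (auto simp: is_iso_def)
  show "irreducible_linear_group class_ring V H"
    unfolding irreducible_linear_group_def linear_group_def
  proof (intro conjI allI impI)
    fix U assume U: "VectorSpace.subspace class_ring U V \<and> (\<forall>h\<in>H. h ` U \<subseteq> U)"
    then have "U \<subseteq> carrier V" using V.subspace_subset by blast
    then have "\<rho> g u \<in> U" if "g \<in> carrier G" "u \<in> U" for g u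
      using U that by (force simp: H_def)
    then show "U = {\<zero>\<^bsub>V\<^esub>} \<or> U = carrier V" using irreducible U by blast
  qed (use V.vectorspace_axioms fd H nontrivial in auto)
qed

lemma faithful_irrep_of_linear_group:
  fixes V :: "('k :: field_char_0, 'v) module"
  assumes G: "group G" and H: "irreducible_linear_group class_ring V H"
    and \<phi>: "\<phi> \<in> iso G ((GL class_ring V)\<lparr>carrier := H\<rparr>)"
  shows "faithful_irrep V G \<phi>" and "\<And>g. g \<in> carrier G \<Longrightarrow> \<phi> g \<in> extensional (carrier V)"
    and "\<phi> ` carrier G = H"
proof -
  interpret G: group G by (rule G)
  have V: "vectorspace class_ring V" and sub: "subgroup H (GL class_ring V)"
    and nz: "carrier V \<noteq> {\<zero>\<^bsub>V\<^esub>}"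
    and irr: "\<And>U. VectorSpace.subspace class_ring U V \<Longrightarrow> \<forall>h\<in>H. h ` U \<subseteq> U \<Longrightarrow> U = {\<zero>\<^bsub>V\<^esub>} \<or> U = carrier V"
    using H by (auto simp: irreducible_linear_group_def linear_group_def)
  show img: "\<phi> ` carrier G = H" using \<phi> by (simp add: iso_def bij_betw_def)
  have GL: "\<phi> g \<in> carrier (GL class_ring V)" if "g \<in> carrier G" for g
    using that img subgroup.subset[OF sub] by blast
  then have hom: "\<phi> g \<in> LinearCombinations.module_hom class_ring V V" and Bij: "\<phi> g \<in> Bij (carrier V)"
    if "g \<in> carrier G" for g
    using that by (auto simp: GL_simps)
  show ext: "\<phi> g \<in> extensional (carrier V)" if "g \<in> carrier G" for g
    using Bij[OF that] Bij_imp_extensional by blast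
  have closed: "\<phi> g v \<in> carrier V" if "g \<in> carrier G" "v \<in> carrier V" for g v
    using Bij_imp_funcset[OF Bij[OF that(1)]] that(2) by auto
  have mult: "\<phi> (g \<otimes>\<^bsub>G\<^esub> h) v = \<phi> g (\<phi> h v)" if "g \<in> carrier G" "h \<in> carrier G" "v \<in> carrier V" for g h v
  proof -
    have "\<phi> (g \<otimes>\<^bsub>G\<^esub> h) = \<phi> g \<otimes>\<^bsub>GL class_ring V\<^esub> \<phi> h"
      using \<phi> that by (simp add: iso_def hom_def)
    then show ?thesis using GL_mult[OF GL[OF that(1)] GL[OF that(2)]] that(3) by (simp add: compose_def)
  qed
  have one: "\<phi> \<one>\<^bsub>G\<^esub> v = v" if v: "v \<in> carrier V" for v
  proof -
    have "inj_on (\<phi> \<one>\<^bsub>G\<^esub>) (carrier V)" using Bij[OF G.one_closed] by (auto simp: Bij_def bij_betw_def)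
    moreover have "\<phi> \<one>\<^bsub>G\<^esub> (\<phi> \<one>\<^bsub>G\<^esub> v) = \<phi> \<one>\<^bsub>G\<^esub> v" using mult[of "\<one>\<^bsub>G\<^esub>" "\<one>\<^bsub>G\<^esub>" v] v by simp
    ultimately show ?thesis using closed[OF G.one_closed v] v by (meson inj_onD)
  qed
  show "faithful_irrep V G \<phi>"
  proof (rule faithful_irrep.intro[OF V], rule faithful_irrep_axioms.intro)
    show "group G" by (rule G)
    show "\<phi> g (u \<oplus>\<^bsub>V\<^esub> v) = \<phi> g u \<oplus>\<^bsub>V\<^esub> \<phi> g v" if "g \<in> carrier G" "u \<in> carrier V" "v \<in> carrier V" for g u v
      using LinearCombinations.module_hom_add[OF hom] that by blast
    show "\<phi> g (c \<odot>\<^bsub>V\<^esub> v) = c \<odot>\<^bsub>V\<^esub> \<phi> g v" if "g \<in> carrier G" "v \<in> carrier V" for g c v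
      using LinearCombinations.module_hom_smult[OF hom[OF that(1)], of c v] that by simp
    show "g = \<one>\<^bsub>G\<^esub>" if g: "g \<in> carrier G" and triv: "\<And>v. v \<in> carrier V \<Longrightarrow> \<phi> g v = v" for g
    proof -
      have "\<phi> g = \<phi> \<one>\<^bsub>G\<^esub>"
        by (rule extensionalityI[OF ext[OF g] ext[OF G.one_closed]]) (simp add: triv one)
      moreover have "inj_on \<phi> (carrier G)" using \<phi> by (simp add: iso_def bij_betw_def)
      ultimately show ?thesis using g G.one_closed by (meson inj_onD)
    qed
    show "U = {\<zero>\<^bsub>V\<^esub>} \<or> U = carrier V"
      if "VectorSpace.subspace class_ring U V" "\<And>g u. g \<in> carrier G \<Longrightarrow> u \<in> U \<Longrightarrow> \<phi> g u \<in> U" for U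
      using irr[OF that(1)] that(2) img by blast
  qed (use closed mult one nz in auto)
qed

theorem theorem3p1:
  fixes G :: "('a, 'b) monoid_scheme"
  assumes "ANC_group G"
  shows "(\<exists>(V :: ('k::field_char_0, 'k vec) module) H.
            irreducible_linear_group class_ring V H \<and> G \<cong> (GL class_ring V)\<lparr>carrier := H\<rparr>) \<and>
         (\<forall>(V :: ('k, 'v) module) H (W :: ('k, 'w) module) H'.
            irreducible_linear_group class_ring V H \<and> G \<cong> (GL class_ring V)\<lparr>carrier := H\<rparr> \<and>
            irreducible_linear_group class_ring W H' \<and> G \<cong> (GL class_ring W)\<lparr>carrier := H'\<rparr> \<longrightarrow>
            similar_linear_groups class_ring V H W H')"
proof -
  have G: "group G" using assms by (simp add: ANC_group_def nilpotent_group_def)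
  obtain a s where "ANC_cyclic G a s" by (rule group.ANC_cyclic_exists[OF G assms])
  then interpret ANC_cyclic G a s .
  show ?thesis
  proof (intro conjI allI impI; (elim conjE)?)
    obtain V :: "('k, 'k vec) module" and \<rho> where V: "faithful_irrep V G \<rho>" "vectorspace.fin_dim class_ring V"
      by (rule faithful_irrep_exists)
    show "\<exists>(V :: ('k, 'k vec) module) H.
        irreducible_linear_group class_ring V H \<and> G \<cong> (GL class_ring V)\<lparr>carrier := H\<rparr>"
      using faithful_irrep.linear_group_of_irrep[OF V] by blast
  next
    fix V :: "('k, 'v) module" and H and W :: "('k, 'w) module" and H'
    assume H: "irreducible_linear_group class_ring V H" "G \<cong> (GL class_ring V)\<lparr>carrier := H\<rparr>"
      and H': "irreducible_linear_group class_ring W H'" "G \<cong> (GL class_ring W)\<lparr>carrier := H'\<rparr>"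
    obtain \<phi> \<psi> where \<phi>: "\<phi> \<in> iso G ((GL class_ring V)\<lparr>carrier := H\<rparr>)"
      and \<psi>: "\<psi> \<in> iso G ((GL class_ring W)\<lparr>carrier := H'\<rparr>)"
      using H(2) H'(2) by (auto simp: is_iso_def)
    note R = faithful_irrep_of_linear_group[OF G H(1) \<phi>]
    note S = faithful_irrep_of_linear_group[OF G H'(1) \<psi>]
    interpret R: faithful_irrep V G \<phi> by (rule R(1))
    interpret S: faithful_irrep W G \<psi> by (rule S(1))
    interpret P: irrep_pair G a s V \<phi> W \<psi> ..
    have fd: "R.V.fin_dim" using H(1) by (simp add: irreducible_linear_group_def linear_group_def)
    obtain \<alpha> \<theta> where \<alpha>: "\<alpha> \<in> hom G G" "inj_on \<alpha> (carrier G)"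
      and \<theta>: "\<theta> \<in> LinearCombinations.module_hom class_ring V W" "bij_betw \<theta> (carrier V) (carrier W)"
      and eq: "\<And>x v. x \<in> carrier G \<Longrightarrow> v \<in> carrier V \<Longrightarrow> \<theta> (\<phi> x v) = \<psi> (\<alpha> x) (\<theta> v)"
      using P.equivalent_up_to_automorphism[OF fd] by metis
    have \<alpha>c: "\<alpha> x \<in> carrier G" if "x \<in> carrier G" for x using \<alpha>(1) that by (rule hom_in_carrier)
    have \<alpha>_surj: "\<alpha> ` carrier G = carrier G"
      by (rule endo_inj_surj[OF finite_carrier _ \<alpha>(2)]) (use \<alpha>c in auto)
    have conj: "(\<lambda>w\<in>carrier W. \<theta> (\<phi> x (inv_into (carrier V) \<theta> w))) = \<psi> (\<alpha> x)" if x: "x \<in> carrier G" for x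
    proof (rule extensionalityI[OF restrict_extensional S(2)[OF \<alpha>c[OF x]]])
      fix w assume w: "w \<in> carrier W"
      have "inv_into (carrier V) \<theta> w \<in> carrier V"
        using bij_betwE[OF bij_betw_inv_into[OF \<theta>(2)]] w by blast
      then show "(\<lambda>w\<in>carrier W. \<theta> (\<phi> x (inv_into (carrier V) \<theta> w))) w = \<psi> (\<alpha> x) w"
        using w eq[OF x] bij_betw_inv_into_right[OF \<theta>(2) w] by simp
    qed
    have "(\<lambda>g. \<lambda>w\<in>carrier W. \<theta> (g (inv_into (carrier V) \<theta> w))) ` H
        = (\<lambda>x. \<psi> (\<alpha> x)) ` carrier G"
      unfolding R(3)[symmetric] image_image using conj by simp
    also have "\<dots> = \<psi> ` (\<alpha> ` carrier G)" by (simp only: image_image)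
    also have "\<dots> = H'" unfolding \<alpha>_surj by (rule S(3))
    finally show "similar_linear_groups class_ring V H W H'"
      using \<theta> unfolding similar_linear_groups_def linear_isos_def by blast
  qed
qed

end
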